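(* Assume that for each state $l\in S$ $$P_l\Bigl(\bigl\{x\in\mathcal X: f_l(x)\max_{j\in S}p_{jl}>\max_{i\in S,\,i\neq l}\{f_i(x)\max_{j\in S}p_{ji}\}\bigr\}\Bigr)>0.$$ Moreover, assume that there exist a cluster $C\subset S$ and a finite integer $m<\infty$ such that the $m$-th power of the sub-stochastic matrix $\mathbb Q=(p_{ij})_{i,j\in C}$ has all of its entries non-zero. Then, for some integers $M$ and $r$ with $M>r\ge0$, there exist a set $B=B_1\times\cdots\times B_M\subset\mathcal X^M$, an $M$-tuple of states $q_{1\ldots M}\in S^M$, and a state $l\in S$, such that every vector $y\in B$ is an $l$-barrier of order $r$, $q_{M-r}=l$, and $$\mathbf P\bigl((X_1,\ldots,X_M)\in B\mid Y_1=q_1,\ldots,Y_M=q_M\bigr)>0,\qquad \mathbf P(Y_1=q_1,\ldots,Y_M=q_M)>0.$$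
   Context: **Model.** $Y=(Y_1,Y_2,\ldots)$ is an irreducible aperiodic Markov chain with finite state space $S=\{1,\ldots,K\}$, transition matrix $\mathbb P=(p_{ij})$ and initial distribution $\pi$, which is the stationary distribution. $\mathcal X$ is a separable metric space with Borel $\sigma$-algebra $\mathcal B$. For each $l\in S$, $P_l$ is a probability measure on $(\mathcal X,\mathcal B)$ with density $f_l$ with respect to a dominating measure $\lambda$. $X=(X_1,X_2,\ldots)$ is the hidden Markov model: given $Y$, the $X_n$ are independent and $X_n\sim P_{Y_n}$. Notation: $x_{a\ldots b}=(x_a,\ldots,x_b)$. **Cluster.** $G_i$ is the support of $P_i$ (the intersection of all closed sets of $P_i$-probability 1). $C\subset S$ is a cluster if $\min_{j\in C}P_j\bigl(\bigcap_{i\in C}G_i\cap\{x:f_i(x)>0\}\bigr)>0$ and $P_j(\bigcap_{i\in C}G_i)=0$ for all $j\notin C$. **Nodes.** For $q\in S^n$, $\Lambda(q;x_{1\ldots n})=\pi_{q_1}\prod_{i=2}^n p_{q_{i-1}q_i}\prod_{i=1}^n f_{q_i}(x_i)$. $\delta_u(l)=\max\{\Lambda(q;x_{1\ldots u}):q\in S^u,\,q_u=l\}$. $p^{(0)}_{ij}(u)=p_{ij}$ and, for $r\ge1$, $p^{(r)}_{ij}(u)=\max_{q_{1\ldots r}\in S^r}p_{iq_1}f_{q_1}(x_{u+1})p_{q_1q_2}f_{q_2}(x_{u+2})\cdots p_{q_{r-1}q_r}f_{q_r}(x_{u+r})p_{q_rj}$. For a string of observations $x_{1\ldots n}$ and $u\le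 n-r$, $x_u$ is an $l$-node of order $r$ if $\delta_u(l)p^{(r)}_{lj}(u)\ge\delta_u(i)p^{(r)}_{ij}(u)$ for all $i,j\in S$. **Barriers.** A block $x^b_{1\ldots k}\in\mathcal X^k$ ($k\ge r$) is an $l$-barrier of order $r$ and length $k$ if for any $w>0$ and any $x'_{1\ldots w}\in\mathcal X^w$, the $(w+k-r)$-th element of $(x'_{1\ldots w},x^b_{1\ldots k})$ is an $l$-node of order $r$. *)

theory Defs
  imports "HOL-Probability.Probability"
begin

text \<open>
  The finite state space is a type of class \<^class>\<open>finite\<close>. A separable metric space is
  rendered by the classes \<^class>\<open>metric_space\<close> and \<^class>\<open>second_countable_topology\<close>
  (for metric spaces, second countable is the same as separable). The stochastic processes are
  indexed from 1; their values at index 0 are irrelevant. Finite strings are lists, so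
  the entry with (one-based) index \<open>i\<close> of a string \<open>x\<close> is \<open>x ! (i - 1)\<close>.
\<close>

text \<open>The \<open>n\<close>-th power of the matrix \<open>(p i j)\<close> with \<open>i\<close> and \<open>j\<close> restricted to \<open>A\<close>;
  only meaningful at indices in \<open>A\<close>.\<close>

primrec submatrix_power :: "('s \<Rightarrow> 's \<Rightarrow> real) \<Rightarrow> 's set \<Rightarrow> nat \<Rightarrow> 's \<Rightarrow> 's \<Rightarrow> real" where
  "submatrix_power p A 0 i j = (if i = j then 1 else 0)"
| "submatrix_power p A (Suc n) i j = (\<Sum>k\<in>A. p i k * submatrix_power p A n k j)"

definition irreducible_matrix :: "('s::finite \<Rightarrow> 's \<Rightarrow> real) \<Rightarrow> bool" where
  "irreducible_matrix p \<longleftrightarrow> (\<forall>i j. \<exists>n. submatrix_power p UNIV n i j > 0)"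

definition aperiodic_matrix :: "('s::finite \<Rightarrow> 's \<Rightarrow> real) \<Rightarrow> bool" where
  "aperiodic_matrix p \<longleftrightarrow> (\<forall>i. Gcd {n. n \<ge> 1 \<and> submatrix_power p UNIV n i i > 0} = 1)"

locale markov_chain = prob_space \<Omega>
  for \<Omega> :: "'w measure" +
  fixes Y :: "nat \<Rightarrow> 'w \<Rightarrow> 's::finite"
    and p :: "'s \<Rightarrow> 's \<Rightarrow> real"
    and \<pi> :: "'s \<Rightarrow> real"
  assumes measurable_Y: "\<And>n. n \<ge> 1 \<Longrightarrow> Y n \<in> measurable \<Omega> (count_space UNIV)"
    and p_nonneg: "\<And>i j. p i j \<ge> 0"
    and p_row_sum: "\<And>i. (\<Sum>j\<in>UNIV. p i j) = 1"
    and initial: "\<And>i. \<P>(\<omega> in \<Omega>. Y 1 \<omega> = i) = \<pi> i"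
    and transition: "\<And>n q j. n \<ge> 1 \<Longrightarrow> \<P>(\<omega> in \<Omega>. \<forall>i\<in>{1..n}. Y i \<omega> = q i) > 0 \<Longrightarrow>
      \<P>(\<omega> in \<Omega>. Y (Suc n) \<omega> = j \<bar> \<forall>i\<in>{1..n}. Y i \<omega> = q i) = p (q n) j"

text \<open>The \<open>\<sigma>\<close>-algebra generated by the whole process \<open>Y 1, Y 2, \<dots>\<close>.\<close>

definition process_sigma :: "'w measure \<Rightarrow> (nat \<Rightarrow> 'w \<Rightarrow> 's) \<Rightarrow> 'w measure" where
  "process_sigma \<Omega> Y = sigma (space \<Omega>) {Y n -` A \<inter> space \<Omega> | n A. n \<ge> 1}"

text \<open>The assumption \<open>emission\<close> says that, conditionally on the whole process \<open>Y\<close>, the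
  observations \<open>X n\<close> are independent with laws \<open>P (Y n)\<close>. The parameter \<open>lam\<close> is the
  dominating measure.\<close>

locale hidden_markov_model = markov_chain \<Omega> Y p \<pi>
  for \<Omega> :: "'w measure"
    and Y :: "nat \<Rightarrow> 'w \<Rightarrow> 's::finite"
    and p :: "'s \<Rightarrow> 's \<Rightarrow> real"
    and \<pi> :: "'s \<Rightarrow> real" +
  fixes X :: "nat \<Rightarrow> 'w \<Rightarrow> 'x::{metric_space, second_countable_topology}"
    and P :: "'s \<Rightarrow> 'x measure"
    and lam :: "'x measure"
    and f :: "'s \<Rightarrow> 'x \<Rightarrow> real"
  assumes irreducible: "irreducible_matrix p"
    and aperiodic: "aperiodic_matrix p"
    and stationary: "\<And>j. (\<Sum>i\<in>UNIV. \<pi> i * p i j) = \<pi> j"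
    and sets_lam: "sets lam = sets borel"
    and f_measurable: "\<And>l. f l \<in> borel_measurable borel"
    and f_nonneg: "\<And>l x. f l x \<ge> 0"
    and prob_space_P: "\<And>l. prob_space (P l)"
    and P_density: "\<And>l. P l = density lam (\<lambda>x. ennreal (f l x))"
    and measurable_X: "\<And>n. n \<ge> 1 \<Longrightarrow> X n \<in> measurable \<Omega> borel"
    and emission: "\<And>n A. (\<And>i. i \<in> {1..n} \<Longrightarrow> A i \<in> sets borel) \<Longrightarrow>
      AE \<omega> in \<Omega>. real_cond_exp \<Omega> (process_sigma \<Omega> Y)
          (indicat_real {\<omega> \<in> space \<Omega>. \<forall>i\<in>{1..n}. X i \<omega> \<in> A i}) \<omega>
        = (\<Prod>i=1..n. measure (P (Y i \<omega>)) (A i))"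

definition measure_support :: "'x::topological_space measure \<Rightarrow> 'x set" where
  "measure_support N = \<Inter>{F. closed F \<and> measure N F = 1}"

definition cluster ::
  "('s::finite \<Rightarrow> 'x::topological_space measure) \<Rightarrow> ('s \<Rightarrow> 'x \<Rightarrow> real) \<Rightarrow> 's set \<Rightarrow> bool" where
  "cluster P f C \<longleftrightarrow> C \<noteq> {} \<and>
     Min ((\<lambda>j. measure (P j) (\<Inter>i\<in>C. measure_support (P i) \<inter> {x. f i x > 0})) ` C) > 0 \<and>
     (\<forall>j. j \<notin> C \<longrightarrow> measure (P j) (\<Inter>i\<in>C. measure_support (P i)) = 0)"

definition likelihood ::
  "('s \<Rightarrow> real) \<Rightarrow> ('s \<Rightarrow> 's \<Rightarrow> real) \<Rightarrow> ('s \<Rightarrow> 'x \<Rightarrow> real) \<Rightarrow> 's list \<Rightarrow> 'x list \<Rightarrow> real" where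
  "likelihood \<pi> p f q x =
     \<pi> (q ! 0) * (\<Prod>i=1..<length x. p (q ! (i - 1)) (q ! i)) * (\<Prod>i<length x. f (q ! i) (x ! i))"

text \<open>The score \<open>\<delta>\<^sub>u(l)\<close>, for \<open>1 \<le> u \<le> length x\<close>.\<close>

definition delta_score ::
  "('s::finite \<Rightarrow> real) \<Rightarrow> ('s \<Rightarrow> 's \<Rightarrow> real) \<Rightarrow> ('s \<Rightarrow> 'x \<Rightarrow> real) \<Rightarrow> 'x list \<Rightarrow> nat \<Rightarrow> 's \<Rightarrow> real" where
  "delta_score \<pi> p f x u l =
     Max ((\<lambda>q. likelihood \<pi> p f q (take u x)) ` {q. length q = u \<and> last q = l})"

text \<open>The quantity \<open>p\<^sup>(\<^sup>r\<^sup>)\<^sub>i\<^sub>j(u)\<close>, for \<open>u + r \<le> length x\<close>. The case \<open>r = 0\<close> needs no separate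
  clause, see the lemma below.\<close>

definition max_path ::
  "('s::finite \<Rightarrow> 's \<Rightarrow> real) \<Rightarrow> ('s \<Rightarrow> 'x \<Rightarrow> real) \<Rightarrow> 'x list \<Rightarrow> nat \<Rightarrow> nat \<Rightarrow> 's \<Rightarrow> 's \<Rightarrow> real" where
  "max_path p f x r u i j =
     Max ((\<lambda>q. (let s = i # q @ [j] in \<Prod>k\<le>r. p (s ! k) (s ! Suc k)) *
               (\<Prod>k<r. f (q ! k) (x ! (u + k)))) ` {q. length q = r})"

lemma max_path_0: "max_path p f x 0 u i j = p i j"
  by (simp add: max_path_def)

definition is_node ::
  "('s::finite \<Rightarrow> real) \<Rightarrow> ('s \<Rightarrow> 's \<Rightarrow> real) \<Rightarrow> ('s \<Rightarrow> 'x \<Rightarrow> real) \<Rightarrow> 'x list \<Rightarrow> nat \<Rightarrow> nat \<Rightarrow> 's \<Rightarrow> bool" where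
  "is_node \<pi> p f x r u l \<longleftrightarrow> 1 \<le> u \<and> u + r \<le> length x \<and>
     (\<forall>i j. delta_score \<pi> p f x u l * max_path p f x r u l j
          \<ge> delta_score \<pi> p f x u i * max_path p f x r u i j)"

definition is_barrier ::
  "('s::finite \<Rightarrow> real) \<Rightarrow> ('s \<Rightarrow> 's \<Rightarrow> real) \<Rightarrow> ('s \<Rightarrow> 'x \<Rightarrow> real) \<Rightarrow> nat \<Rightarrow> 's \<Rightarrow> 'x list \<Rightarrow> bool" where
  "is_barrier \<pi> p f r l xb \<longleftrightarrow> r \<le> length xb \<and>
     (\<forall>x'. length x' > 0 \<longrightarrow> is_node \<pi> p f (x' @ xb) r (length x' + length xb - r) l)"

end

theory Submission
  imports Defs
begin

text \<open>
  Write \<open>p*\<^sub>j\<close> for the largest entry of column \<open>j\<close> of \<open>p\<close>. By hypothesis \<open>P\<^sub>l\<close> charges the set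
  of \<open>x\<close> at which \<open>l\<close> is the strict maximiser of \<open>f\<^sub>l(x) p*\<^sub>l\<close>, and also a slightly smaller set
  on which the other values are at most \<open>\<rho> f\<^sub>l(x) p*\<^sub>l\<close> for some \<open>\<rho> < 1\<close> common to all states.
  Follow, from any state, the map that sends \<open>j\<close> to a predecessor attaining \<open>p*\<^sub>j\<close>; on a finite
  state space it has a periodic point \<open>l\<close>. Read forwards, its orbit is a cycle of states that
  uses only maximal transitions. If the observations along the cycle are taken from these
  smaller sets, then at each time the cycle has a step weight at least as large as any other
  step, and a path that is off the cycle at some time loses there a factor \<open>\<rho>\<close>.

  The barrier has the shape
  \<open>Z\<^sup>m\<^sup>+\<^sup>1, (route c\<^sub>0 to l), (2N steps on the cycle), (route l to c\<^sub>0), Z\<^sup>m\<close>, where \<open>c\<^sub>0\<close> lies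
  in the cluster \<open>C\<close> and \<open>Z\<close> consists of observations at which exactly the densities of the
  states in \<open>C\<close> are positive, within fixed bounds. A path of positive likelihood is thus forced
  into \<open>C\<close> at both ends of the block, and since the \<open>m\<close>-th power of the matrix \<open>(p i j)\<close>
  restricted to \<open>C\<close> has no zero entry it can be replaced, from whatever state of \<open>C\<close> it starts
  in to whatever state of \<open>C\<close> it ends in, by a path that goes to \<open>c\<^sub>0\<close>, runs through the cycle
  and returns.

  Consider now the middle of the cycle, where the cycle is in \<open>l\<close>, and any path. If the path
  meets the cycle both before and after that time, replacing it by the cycle between the two
  meetings cannot decrease its likelihood (\<open>reroute_between_meetings\<close>). Otherwise it misses \<open>N\<close>
  consecutive states of the cycle, so it has lost \<open>\<rho>\<^sup>N\<close>; the replacement of the whole block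
  loses at most a factor that depends on the ends of the block but not on \<open>N\<close>, and wins for \<open>N\<close>
  large (\<open>reroute_through_centre\<close>). In both cases the endpoints of the path are kept, so a best
  path may be assumed to pass through \<open>l\<close>, whatever precedes and follows the block; this is the
  node property (\<open>is_nodeI\<close>, \<open>barrier_block\<close>).

  All observation sets are charged by the laws of the intended states
  (\<open>eventually_dominance_set_pos\<close>, \<open>eventually_cluster_set_pos\<close>) and all transitions between
  those states are possible, so the required probabilities are positive (\<open>block_prob_pos\<close>).
\<close>

section \<open>Path weights and rerouting\<close>

definition path_weight :: "(nat \<Rightarrow> 's \<Rightarrow> 's \<Rightarrow> real) \<Rightarrow> nat \<Rightarrow> nat \<Rightarrow> (nat \<Rightarrow> 's) \<Rightarrow> real" where
  "path_weight g a b q = (\<Prod>t\<in>{a<..b}. g t (q (t - 1)) (q t))"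

lemma path_weight_split:
  assumes "a \<le> b" "b \<le> c"
  shows "path_weight g a c q = path_weight g a b q * path_weight g b c q"
proof -
  have "{a<..c} = {a<..b} \<union> {b<..c}" using assms by auto
  then show ?thesis unfolding path_weight_def
    by (simp add: prod.union_disjoint)
qed

lemma path_weight_cong:
  assumes "\<And>t. a \<le> t \<Longrightarrow> t \<le> b \<Longrightarrow> q t = q' t"
  shows "path_weight g a b q = path_weight g a b q'"
  unfolding path_weight_def by (rule prod.cong) (use assms in auto)

lemma path_weight_nonneg:
  assumes "\<And>t i j. g t i j \<ge> 0"
  shows "path_weight g a b q \<ge> 0"
  unfolding path_weight_def by (intro prod_nonneg) (use assms in auto)

lemma path_weight_le_power:
  assumes "\<And>t i j. g t i j \<ge> 0"
    and "\<And>t i j. a < t \<Longrightarrow> t \<le> b \<Longrightarrow> g t i j \<le> K"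
  shows "path_weight g a b q \<le> K ^ (b - a)"
proof -
  have "path_weight g a b q \<le> (\<Prod>t\<in>{a<..b}. K)"
    unfolding path_weight_def by (intro prod_mono) (use assms in auto)
  then show ?thesis by simp
qed

lemma path_weight_ge_power:
  assumes "h \<ge> 0"
    and "\<And>t. a < t \<Longrightarrow> t \<le> b \<Longrightarrow> h \<le> g t (q (t - 1)) (q t)"
  shows "h ^ (b - a) \<le> path_weight g a b q"
proof -
  have "(\<Prod>t\<in>{a<..b}. h) \<le> path_weight g a b q"
    unfolding path_weight_def by (intro prod_mono) (use assms in auto)
  then show ?thesis by simp
qed

lemma path_weight_le_dominant:
  assumes nonneg: "\<And>t i j. g t i j \<ge> 0"
    and dom: "\<And>t i j. a < t \<Longrightarrow> t \<le> b \<Longrightarrow> g t i j \<le> g t (c (t - 1)) (c t)"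
  shows "path_weight g a b q \<le> path_weight g a b c"
  unfolding path_weight_def by (intro prod_mono) (use assms in auto)

lemma path_weight_le_avoiding:
  assumes nonneg: "\<And>t i j. g t i j \<ge> 0"
    and dom: "\<And>t i j. a < t \<Longrightarrow> t \<le> b \<Longrightarrow> j \<noteq> c t \<Longrightarrow> g t i j \<le> \<rho> * g t (c (t - 1)) (c t)"
    and avoid: "\<And>t. a < t \<Longrightarrow> t \<le> b \<Longrightarrow> q t \<noteq> c t"
  shows "path_weight g a b q \<le> \<rho> ^ (b - a) * path_weight g a b c"
proof -
  have "path_weight g a b q \<le> (\<Prod>t\<in>{a<..b}. \<rho> * g t (c (t - 1)) (c t))"
    unfolding path_weight_def by (intro prod_mono) (use assms in auto)
  then show ?thesis by (simp add: path_weight_def prod.distrib)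
qed

text \<open>
  The two junctions cost nothing: the weight of a step depends on both of its ends, and at the
  meeting times the old and the new path agree.
\<close>

lemma reroute_between_meetings:
  assumes nonneg: "\<And>t i j. g t i j \<ge> 0"
    and dom: "\<And>t i j. a < t \<Longrightarrow> t \<le> b \<Longrightarrow> g t i j \<le> g t (c (t - 1)) (c t)"
    and ord: "w \<le> a" "a \<le> b" "b \<le> e"
    and meet: "q a = c a" "q b = c b"
  shows "path_weight g w e q \<le> path_weight g w e (\<lambda>t. if a \<le> t \<and> t \<le> b then c t else q t)"
proof -
  let ?q = "\<lambda>t. if a \<le> t \<and> t \<le> b then c t else q t"
  have split: "path_weight g w e r = path_weight g w a r * path_weight g a b r * path_weight g b e r" for r
    using ord by (simp add: path_weight_split[of w a e] path_weight_split[of a b e])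
  have "path_weight g w a ?q = path_weight g w a q"
    by (rule path_weight_cong) (use ord meet in auto)
  moreover have "path_weight g b e ?q = path_weight g b e q"
    by (rule path_weight_cong) (use ord meet in auto)
  moreover have "path_weight g a b ?q = path_weight g a b c"
    by (rule path_weight_cong) auto
  moreover have "path_weight g a b q \<le> path_weight g a b c"
    by (rule path_weight_le_dominant) (use nonneg dom in auto)
  ultimately show ?thesis
    by (simp add: split) (intro mult_right_mono mult_left_mono path_weight_nonneg nonneg)
qed

text \<open>
  The reference path \<open>c\<close> dominates every step on \<open>{A<..A'}\<close>, with a gap \<open>\<rho>\<close> at each time where a
  competitor is elsewhere; \<open>U\<close> is at least \<open>N\<close> steps from both ends. Either \<open>q\<close> meets \<open>c\<close> on
  both sides of \<open>U\<close> and can follow \<open>c\<close> in between, or it avoids \<open>c\<close> for \<open>N\<close> steps on one side.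
  In the second case the factor \<open>\<rho> ^ N\<close> pays for replacing all of \<open>{w..e}\<close> by the route \<open>r1\<close>,
  the path \<open>c\<close> and the route \<open>r2\<close>, whose steps outside the centre have weight at least \<open>h\<close>
  instead of at most \<open>K\<close>.
\<close>

lemma reroute_through_centre:
  assumes nonneg: "\<And>t i j. g t i j \<ge> 0"
    and ord: "w \<le> A" "A + N \<le> U" "U + N \<le> A'" "A' \<le> e"
    and rho: "0 \<le> \<rho>" "\<rho> \<le> 1" and h: "0 \<le> h" and K: "0 \<le> K"
    and dom: "\<And>t i j. A < t \<Longrightarrow> t \<le> A' \<Longrightarrow> g t i j \<le> g t (c (t - 1)) (c t)"
    and gap: "\<And>t i j. A < t \<Longrightarrow> t \<le> A' \<Longrightarrow> j \<noteq> c t \<Longrightarrow> g t i j \<le> \<rho> * g t (c (t - 1)) (c t)"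
    and bound: "\<And>t i j. w < t \<Longrightarrow> t \<le> A \<Longrightarrow> g t i j \<le> K"
      "\<And>t i j. A' < t \<Longrightarrow> t \<le> e \<Longrightarrow> g t i j \<le> K"
    and r1: "r1 w = q w" "r1 A = c A"
      "\<And>t. w < t \<Longrightarrow> t \<le> A \<Longrightarrow> h \<le> g t (r1 (t - 1)) (r1 t)"
    and r2: "r2 A' = c A'" "r2 e = q e"
      "\<And>t. A' < t \<Longrightarrow> t \<le> e \<Longrightarrow> h \<le> g t (r2 (t - 1)) (r2 t)"
    and small: "K ^ (A - w) * K ^ (e - A') * \<rho> ^ N \<le> h ^ (A - w) * h ^ (e - A')"
  obtains q' where "q' U = c U" "\<And>t. t \<le> w \<or> e \<le> t \<Longrightarrow> q' t = q t"
    "path_weight g w e q \<le> path_weight g w e q'"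
proof (cases "(\<exists>a. A < a \<and> a \<le> U \<and> q a = c a) \<and> (\<exists>b. U < b \<and> b \<le> A' \<and> q b = c b)")
  case True
  then obtain a b where ab: "A < a" "a \<le> U" "q a = c a" "U < b" "b \<le> A'" "q b = c b" by auto
  let ?q = "\<lambda>t. if a \<le> t \<and> t \<le> b then c t else q t"
  show thesis
  proof (rule that[of ?q])
    show "?q U = c U" using ab by simp
    show "path_weight g w e q \<le> path_weight g w e ?q"
      by (rule reroute_between_meetings) (use nonneg dom ab ord in auto)
    show "?q t = q t" if "t \<le> w \<or> e \<le> t" for t
    proof -
      have "t < a \<or> b < t \<or> t = b" using that ab(1,5) ord by linarith
      then show ?thesis using ab(6) by auto
    qed
  qed
next
  case False
  let ?q = "\<lambda>t. if t \<le> w \<or> e \<le> t then q t else if t \<le> A then r1 t else if t \<le> A' then c t else r2 t"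
  have split: "path_weight g w e r =
      path_weight g w A r * path_weight g A A' r * path_weight g A' e r" for r
    using ord by (simp add: path_weight_split[of w A e] path_weight_split[of A A' e])
  have W: "path_weight g a b r \<ge> 0" for a b r by (rule path_weight_nonneg[OF nonneg])
  have cycle: "path_weight g A A' q \<le> \<rho> ^ N * path_weight g A A' c"
  proof -
    have s: "path_weight g A A' r = path_weight g A U r * path_weight g U A' r" for r
      using ord by (simp add: path_weight_split[of A U A'])
    have d1: "path_weight g A U q \<le> path_weight g A U c"
      by (rule path_weight_le_dominant) (use nonneg dom ord in auto)
    have d2: "path_weight g U A' q \<le> path_weight g U A' c"
      by (rule path_weight_le_dominant) (use nonneg dom ord in auto)
    have pw: "\<rho> ^ k \<le> \<rho> ^ N" if "N \<le> k" for k
      using rho that by (simp add: power_decreasing)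
    have "path_weight g A U q \<le> \<rho> ^ N * path_weight g A U c \<or>
          path_weight g U A' q \<le> \<rho> ^ N * path_weight g U A' c"
      using False
    proof (elim conjE disjE de_Morgan_conj[THEN iffD1, THEN disjE])
      assume "\<not> (\<exists>a. A < a \<and> a \<le> U \<and> q a = c a)"
      then have "path_weight g A U q \<le> \<rho> ^ (U - A) * path_weight g A U c"
        by (intro path_weight_le_avoiding nonneg gap) (use ord in auto)
      also have "\<dots> \<le> \<rho> ^ N * path_weight g A U c"
        by (intro mult_right_mono pw W) (use ord in auto)
      finally show ?thesis ..
    next
      assume "\<not> (\<exists>b. U < b \<and> b \<le> A' \<and> q b = c b)"
      then have "path_weight g U A' q \<le> \<rho> ^ (A' - U) * path_weight g U A' c"
        by (intro path_weight_le_avoiding nonneg gap) (use ord in auto)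
      also have "\<dots> \<le> \<rho> ^ N * path_weight g U A' c"
        by (intro mult_right_mono pw W) (use ord in auto)
      finally show ?thesis ..
    qed
    then show ?thesis
    proof
      assume "path_weight g A U q \<le> \<rho> ^ N * path_weight g A U c"
      from mult_mono[OF this d2] show ?thesis using rho W by (simp add: s mult.assoc)
    next
      assume "path_weight g U A' q \<le> \<rho> ^ N * path_weight g U A' c"
      from mult_mono[OF d1 this] show ?thesis using rho W by (simp add: s mult_ac)
    qed
  qed
  \<comment> \<open>If a route has length zero, its only time keeps the value of \<open>q\<close>, which must then be
    the value of \<open>c\<close>.\<close>
  have ends: "w = A \<Longrightarrow> q A = c A" "e = A' \<Longrightarrow> q A' = c A'"
    using r1 r2 by auto
  have q1: "path_weight g w A ?q = path_weight g w A r1"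
  proof (rule path_weight_cong)
    fix t assume "w \<le> t" "t \<le> A"
    then consider "t = w" | "w < t" "t < e" | "t = A" "e = A'" "A = A'" using ord by linarith
    then show "?q t = r1 t" using r1 ends ord \<open>t \<le> A\<close> by cases auto
  qed
  have centre: "?q t = c t" if "A \<le> t" "t \<le> A'" for t
  proof -
    from that consider "t = A" "w = A" | "t = A" "w < A" "t < e" | "A < t" "t < e" | "t = A'" "e = A'"
      using ord by linarith
    then show ?thesis using r1 ends ord \<open>t \<le> A'\<close> by cases auto
  qed
  have q2: "path_weight g A A' ?q = path_weight g A A' c"
    by (rule path_weight_cong) (rule centre)
  have q3: "path_weight g A' e ?q = path_weight g A' e r2"
  proof (rule path_weight_cong)
    fix t assume "A' \<le> t" "t \<le> e"
    then consider "t = e" | "t = A'" "t < e" "w = A" "A = A'" | "t = A'" "t < e" "w < A'" "A = A'"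
      | "t = A'" "t < e" "A < A'" "w < A'" | "A' < t" "t < e" using ord by linarith
    then show "?q t = r2 t" using r1 r2 ends ord by cases auto
  qed
  have old: "path_weight g w A q \<le> K ^ (A - w)" "path_weight g A' e q \<le> K ^ (e - A')"
    by (intro path_weight_le_power nonneg bound; simp)+
  have new: "h ^ (A - w) \<le> path_weight g w A r1" "h ^ (e - A') \<le> path_weight g A' e r2"
    by (intro path_weight_ge_power h r1 r2; simp)+
  have "path_weight g w e q \<le> K ^ (A - w) * (\<rho> ^ N * path_weight g A A' c) * K ^ (e - A')"
    unfolding split by (intro mult_mono old cycle mult_nonneg_nonneg W) (use rho K in auto)
  also have "\<dots> = (K ^ (A - w) * K ^ (e - A') * \<rho> ^ N) * path_weight g A A' c" by simp
  also have "\<dots> \<le> (h ^ (A - w) * h ^ (e - A')) * path_weight g A A' c"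
    by (intro mult_right_mono small W)
  also have "\<dots> = h ^ (A - w) * path_weight g A A' c * h ^ (e - A')" by simp
  also have "\<dots> \<le> path_weight g w e ?q"
    unfolding split q1 q2 q3 by (intro mult_mono new order_refl mult_nonneg_nonneg W) (use h in auto)
  finally have "path_weight g w e q \<le> path_weight g w e ?q" .
  show thesis
  proof (rule that[of ?q])
    show "?q U = c U" using ord by (intro centre) auto
  qed (use \<open>path_weight g w e q \<le> path_weight g w e ?q\<close> in auto)
qed

section \<open>Nodes in terms of path weights\<close>

text \<open>
  The product of a score term and a connecting path term is the weight of one uninterrupted
  path: the transition out of position \<open>u\<close>, which has (zero-based) index \<open>u - 1\<close>, is supplied by
  the second factor, whose first entry repeats the state at \<open>u\<close>.
\<close>

lemma score_product:
  fixes Q :: "nat \<Rightarrow> 's::finite" and x :: "'x list"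
  assumes u: "1 \<le> u" "u + r \<le> length x"
  shows "likelihood \<pi> p f (map Q [0..<u]) (take u x) *
      ((let s = Q (u - 1) # map Q [u..<u + r] @ [j] in \<Prod>k\<le>r. p (s ! k) (s ! Suc k)) *
       (\<Prod>k<r. f (map Q [u..<u + r] ! k) (x ! (u + k))))
    = \<pi> (Q 0) * f (Q 0) (x ! 0) *
      path_weight (\<lambda>t i j. p i j * f j (x ! t)) 0 (u + r - 1) Q * p (Q (u + r - 1)) j"
proof -
  have lik: "likelihood \<pi> p f (map Q [0..<u]) (take u x) =
      \<pi> (Q 0) * (\<Prod>i=1..<u. p (Q (i - 1)) (Q i)) * (\<Prod>i<u. f (Q i) (x ! i))"
    using u unfolding likelihood_def
    by (intro arg_cong2[of _ _ _ _ "(*)"] prod.cong) (auto simp: min_def)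
  define s where "s = Q (u - 1) # map Q [u..<u + r] @ [j]"
  have s: "s ! k = Q (u - 1 + k)" if "k \<le> r" for k
    using u that by (cases k) (auto simp: s_def nth_append)
  have s': "s ! Suc r = j" by (simp add: s_def nth_append)
  have "(\<Prod>k\<le>r. p (s ! k) (s ! Suc k)) = (\<Prod>k<r. p (s ! k) (s ! Suc k)) * p (Q (u + r - 1)) j"
    using s[of r] s' u by (simp add: lessThan_Suc_atMost[symmetric])
  also have "(\<Prod>k<r. p (s ! k) (s ! Suc k)) = (\<Prod>k<r. p (Q (u + k - 1)) (Q (u + k)))"
    by (intro prod.cong) (use s u in auto)
  finally have trans: "(\<Prod>k\<le>r. p (s ! k) (s ! Suc k)) =
      (\<Prod>k<r. p (Q (u + k - 1)) (Q (u + k))) * p (Q (u + r - 1)) j" .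
  have em: "(\<Prod>k<r. f (map Q [u..<u + r] ! k) (x ! (u + k))) = (\<Prod>k<r. f (Q (u + k)) (x ! (u + k)))"
    by (intro prod.cong) auto
  have sh: "(\<Prod>k<r. F (u + k)) = (\<Prod>t=u..<u + r. F t)" for F :: "nat \<Rightarrow> real"
    using prod.shift_bounds_nat_ivl[of F 0 u r] by (simp add: lessThan_atLeast0 add.commute)
  have cat: "(\<Prod>i=1..<u. F i) * (\<Prod>t=u..<u + r. F t) = (\<Prod>t=1..<u + r. F t)" for F :: "nat \<Rightarrow> real"
    using u by (intro prod.atLeastLessThan_concat) auto
  have f0: "(\<Prod>i<u. f (Q i) (x ! i)) = f (Q 0) (x ! 0) * (\<Prod>i=1..<u. f (Q i) (x ! i))"
    using u by (simp add: lessThan_atLeast0 prod.atLeast_Suc_lessThan)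
  have "{0<..u + r - 1} = {1..<u + r}" using u by auto
  then have pw: "path_weight (\<lambda>t i j. p i j * f j (x ! t)) 0 (u + r - 1) Q =
     ((\<Prod>i=1..<u. p (Q (i - 1)) (Q i)) * (\<Prod>k<r. p (Q (u + k - 1)) (Q (u + k)))) *
     ((\<Prod>i=1..<u. f (Q i) (x ! i)) * (\<Prod>k<r. f (Q (u + k)) (x ! (u + k))))"
    unfolding sh[of "\<lambda>t. p (Q (t - 1)) (Q t)"] sh[of "\<lambda>t. f (Q t) (x ! t)"] cat
    by (simp add: path_weight_def prod.distrib)
  show ?thesis
    unfolding lik s_def[symmetric] Let_def trans em f0 pw by (simp only: mult_ac)
qed

text \<open>
  Both maxima in the node inequality are attained, so the inequality compares single paths: it
  suffices to reroute each path through \<open>l\<close> at \<open>u\<close> without decreasing its weight, where the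
  weight includes the final transition into \<open>j\<close>.
\<close>

lemma is_nodeI:
  fixes f :: "'s::finite \<Rightarrow> 'x \<Rightarrow> real"
  assumes nonneg: "\<And>i. \<pi> i \<ge> 0" "\<And>i j. p i j \<ge> 0" "\<And>i x. f i x \<ge> 0"
    and u: "1 \<le> u" "u + r \<le> length x"
    and reroute: "\<And>Q j. \<exists>Q'. Q' (u - 1) = l \<and>
      \<pi> (Q 0) * f (Q 0) (x ! 0) *
        path_weight (\<lambda>t i j. p i j * f j (x ! t)) 0 (u + r - 1) Q * p (Q (u + r - 1)) j \<le>
      \<pi> (Q' 0) * f (Q' 0) (x ! 0) *
        path_weight (\<lambda>t i j. p i j * f j (x ! t)) 0 (u + r - 1) Q' * p (Q' (u + r - 1)) j"
  shows "is_node \<pi> p f x r u l"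
  unfolding is_node_def
proof (intro conjI allI u)
  fix i j
  define m where "m i q = (let s = i # q @ [j] in \<Prod>k\<le>r. p (s ! k) (s ! Suc k)) *
               (\<Prod>k<r. f (q ! k) (x ! (u + k)))" for i q
  have mp: "max_path p f x r u i j = Max (m i ` {q. length q = r})" for i
    by (simp add: max_path_def m_def[abs_def])
  have fin: "finite {q :: 's list. length q = k}" for k
    using finite_lists_length_eq[of "UNIV :: 's set" k] by simp
  have fin': "finite {q :: 's list. length q = k \<and> P q}" for k P
    by (rule finite_subset[OF _ fin[of k]]) auto
  have ne: "{q :: 's list. length q = u \<and> last q = i} \<noteq> {}"
    using u by (auto intro!: exI[of _ "replicate u i"] simp: last_replicate)
  have ne': "{q :: 's list. length q = r} \<noteq> {}" by (auto intro!: exI[of _ "replicate r i"])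
  have "delta_score \<pi> p f x u i \<in> (\<lambda>q. likelihood \<pi> p f q (take u x)) ` {q. length q = u \<and> last q = i}"
    unfolding delta_score_def by (rule Max_in) (use ne fin' in auto)
  then obtain q where q: "length q = u" "last q = i"
    and dq: "delta_score \<pi> p f x u i = likelihood \<pi> p f q (take u x)" by auto
  have "max_path p f x r u i j \<in> m i ` {q. length q = r}"
    unfolding mp by (rule Max_in) (use ne' fin in auto)
  then obtain q' where q': "length q' = r" and mq: "max_path p f x r u i j = m i q'" by auto
  define Q where "Q t = (q @ q') ! t" for t
  have Q: "q = map Q [0..<u]" "q' = map Q [u..<u + r]"
    using q q' by (auto intro!: nth_equalityI simp: Q_def nth_append)
  have Qu: "Q (u - 1) = i"
    proof -
    have "q \<noteq> []" using q(1) u(1) by auto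
    from last_conv_nth[OF this] show ?thesis using q u by (simp add: Q_def nth_append)
  qed
  have score: "likelihood \<pi> p f (map R [0..<u]) (take u x) * m (R (u - 1)) (map R [u..<u + r]) =
      \<pi> (R 0) * f (R 0) (x ! 0) *
      path_weight (\<lambda>t i j. p i j * f j (x ! t)) 0 (u + r - 1) R * p (R (u + r - 1)) j" for R
    unfolding m_def by (rule score_product[OF u])
  obtain Q' where Q': "Q' (u - 1) = l" and "likelihood \<pi> p f (map Q [0..<u]) (take u x) *
      m (Q (u - 1)) (map Q [u..<u + r]) \<le>
     likelihood \<pi> p f (map Q' [0..<u]) (take u x) * m (Q' (u - 1)) (map Q' [u..<u + r])"
    using reroute[of Q j] unfolding score by blast
  then have le: "likelihood \<pi> p f q (take u x) * m i q' \<le>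
     likelihood \<pi> p f (map Q' [0..<u]) (take u x) * m l (map Q' [u..<u + r])"
    by (simp only: Q(1)[symmetric] Q(2)[symmetric] Qu)
  have "last (map Q' [0..<u]) = l" using Q' u by (simp add: last_map)
  then have d: "likelihood \<pi> p f (map Q' [0..<u]) (take u x) \<le> delta_score \<pi> p f x u l"
    unfolding delta_score_def by (intro Max_ge) (use fin' in auto)
  have e: "m l (map Q' [u..<u + r]) \<le> max_path p f x r u l j"
    unfolding mp by (intro Max_ge) (use fin in auto)
  have n1: "likelihood \<pi> p f s y \<ge> 0" for s y
    unfolding likelihood_def by (intro mult_nonneg_nonneg prod_nonneg nonneg ballI)
  have n2: "m l s \<ge> 0" for s
    unfolding m_def Let_def by (intro mult_nonneg_nonneg prod_nonneg nonneg ballI)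
  show "delta_score \<pi> p f x u i * max_path p f x r u i j \<le> delta_score \<pi> p f x u l * max_path p f x r u l j"
    unfolding dq mq
    by (rule order.trans[OF le mult_mono[OF d e order.trans[OF n1 d] n2]])
qed

section \<open>Blocks that are barriers\<close>

definition positive_path :: "('s \<Rightarrow> 's \<Rightarrow> real) \<Rightarrow> nat \<Rightarrow> (nat \<Rightarrow> 's) \<Rightarrow> bool" where
  "positive_path p n u \<longleftrightarrow> (\<forall>t<n. p (u t) (u (Suc t)) > 0)"

definition path_join :: "nat \<Rightarrow> (nat \<Rightarrow> 's) \<Rightarrow> (nat \<Rightarrow> 's) \<Rightarrow> nat \<Rightarrow> 's" where
  "path_join n u v t = (if t \<le> n then u t else v (t - n))"

lemma path_join_left: "t \<le> n \<Longrightarrow> path_join n u v t = u t"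
  by (simp add: path_join_def)

lemma path_join_right: "u n = v 0 \<Longrightarrow> path_join n u v (n + t) = v t"
  by (simp add: path_join_def)

lemma positive_path_join:
  assumes "positive_path p n u" "positive_path p k v" "u n = v 0"
  shows "positive_path p (n + k) (path_join n u v)"
  unfolding positive_path_def
proof (intro allI impI)
  fix t assume t: "t < n + k"
  show "p (path_join n u v t) (path_join n u v (Suc t)) > 0"
  proof (cases "t < n")
    case True
    then show ?thesis using assms(1) by (simp add: path_join_def positive_path_def)
  next
    case False
    then obtain d where d: "t = n + d" by (metis le_add_diff_inverse linorder_not_less)
    show ?thesis
      using assms(2,3) t path_join_right[of u n v d] path_join_right[of u n v "Suc d"]
      by (simp add: d positive_path_def)
  qed
qed

lemma positive_path_step_ge:
  assumes path: "positive_path p n s" and eta: "\<And>i j. p i j > 0 \<Longrightarrow> p i j \<ge> \<eta>" "\<eta> > 0"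
    and em: "\<And>k. 0 < k \<Longrightarrow> k \<le> n \<Longrightarrow> f (s k) (x ! (a + k)) \<ge> \<eta>"
    and t: "a < t" "t \<le> a + n"
  shows "\<eta> * \<eta> \<le> p (s (t - 1 - a)) (s (t - a)) * f (s (t - a)) (x ! t)"
proof -
  obtain k where k: "t = a + Suc k" using t(1) less_iff_Suc_add by auto
  have "\<eta> \<le> p (s k) (s (Suc k))"
    using path t k eta(1) by (simp add: positive_path_def)
  moreover have "\<eta> \<le> f (s (Suc k)) (x ! t)" using em[of "Suc k"] t k by simp
  ultimately show ?thesis using eta(2) k by (auto intro!: mult_mono)
qed

text \<open>
  The deterministic core. Here \<open>Z\<close> is the set of observations that force the state into \<open>C\<close>, and
  \<open>D s\<close> the set of observations that favour \<open>s\<close>. The entry path \<open>a\<close> and the exit path \<open>b\<close> join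
  \<open>c0\<close> to the dominant path \<open>cyc\<close>; the condition \<open>0 < db\<close> guarantees that the last observation
  of the block lies in \<open>Z\<close> and not on the dominant path even when \<open>m = 0\<close>. In \<open>small\<close>, the
  exponents \<open>m + da\<close> and \<open>db + m\<close> are the numbers of steps before and after the dominant part; a
  step of the replacement there has weight at least \<open>\<eta> * \<eta>\<close>, one factor for the transition and
  one for the density.
\<close>

lemma barrier_block:
  fixes f :: "'s::finite \<Rightarrow> 'x \<Rightarrow> real" and p :: "'s \<Rightarrow> 's \<Rightarrow> real"
  defines "pmax \<equiv> \<lambda>j. Max (range (\<lambda>i. p i j))"
  assumes nonneg: "\<And>i. \<pi> i \<ge> 0" "\<And>i j. p i j \<ge> 0" "\<And>i x. f i x \<ge> 0"
    and p_le_1: "\<And>i j. p i j \<le> 1"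
    and eta: "\<And>i j. p i j > 0 \<Longrightarrow> p i j \<ge> \<eta>" "\<eta> > 0"
    and rho: "0 \<le> \<rho>" "\<rho> \<le> 1" and K: "0 \<le> K"
    and Z: "\<And>x i. x \<in> Z \<Longrightarrow> i \<in> C \<Longrightarrow> f i x \<ge> \<eta>" "\<And>x i. x \<in> Z \<Longrightarrow> i \<notin> C \<Longrightarrow> f i x = 0"
      "\<And>x i. x \<in> Z \<Longrightarrow> f i x \<le> K"
    and D: "\<And>x s. x \<in> D s \<Longrightarrow> f s x \<ge> \<eta>" "\<And>x s i. x \<in> D s \<Longrightarrow> f i x \<le> K"
      "\<And>x s i. x \<in> D s \<Longrightarrow> i \<noteq> s \<Longrightarrow> f i x * pmax i \<le> \<rho> * (f s x * pmax s)"
    and cl: "\<And>s s'. s \<in> C \<Longrightarrow> s' \<in> C \<Longrightarrow>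
      \<exists>z. z 0 = s \<and> z m = s' \<and> positive_path p m z \<and> (\<forall>t\<le>m. z t \<in> C)" "c0 \<in> C"
    and a: "positive_path p da a" "a 0 = c0" "a da = cyc 0"
    and b: "positive_path p db b" "b 0 = cyc (2 * N)" "b db = c0" "0 < db"
    and cyc: "\<And>t. t < 2 * N \<Longrightarrow> p (cyc t) (cyc (Suc t)) = pmax (cyc (Suc t))"
    and small: "K ^ (m + da) * K ^ (db + m) * \<rho> ^ N \<le> (\<eta> * \<eta>) ^ (m + da) * (\<eta> * \<eta>) ^ (db + m)"
    and len: "length xb = m + da + 2 * N + db + m + 1"
    and xb: "\<And>k. k \<le> m \<Longrightarrow> xb ! k \<in> Z"
      "\<And>k. 0 < k \<Longrightarrow> k \<le> da \<Longrightarrow> xb ! (m + k) \<in> D (a k)"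
      "\<And>k. 0 < k \<Longrightarrow> k \<le> 2 * N \<Longrightarrow> xb ! (m + da + k) \<in> D (cyc k)"
      "\<And>k. 0 < k \<Longrightarrow> k < db \<Longrightarrow> xb ! (m + da + 2 * N + k) \<in> D (b k)"
      "\<And>k. k \<le> m \<Longrightarrow> xb ! (m + da + 2 * N + db + k) \<in> Z"
  shows "is_barrier \<pi> p f (N + db + m) (cyc N) xb"
  unfolding is_barrier_def
proof (intro conjI allI impI)
  show "N + db + m \<le> length xb" using len by simp
next
  fix x' :: "'x list" assume w0: "length x' > 0"
  \<comment> \<open>Zero-based times in the string \<open>x\<close>: the block starts at \<open>w\<close>, the dominant part consists of the
    steps in \<open>{A<..A'}\<close>, its middle \<open>U\<close> is the candidate node, and \<open>e\<close> is the last time.\<close>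
  define w where "w = length x'"
  define x where "x = x' @ xb"
  define A where "A = w + m + da"
  define U where "U = A + N"
  define A' where "A' = U + N"
  define e where "e = A' + db + m"
  define g where "g t i j = p i j * f j (x ! t)" for t i j
  have x: "x ! (w + k) = xb ! k" for k by (simp add: x_def w_def)
  have xZ1: "x ! (w + k) \<in> Z" if "k \<le> m" for k using xb(1)[OF that] by (simp add: x)
  have xa: "x ! (w + m + k) \<in> D (a k)" if "0 < k" "k \<le> da" for k
    using xb(2)[OF that] by (simp add: x add.assoc)
  have xc: "x ! (A + k) \<in> D (cyc k)" if "0 < k" "k \<le> 2 * N" for k
    using xb(3)[OF that] by (simp add: A_def x add.assoc)
  have A'_eq: "A' = w + (m + da + 2 * N)" by (simp add: A'_def U_def A_def)
  have xb': "x ! (A' + k) \<in> D (b k)" if "0 < k" "k < db" for k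
    using xb(4)[OF that] x[of "m + da + 2 * N + k"] by (simp add: A'_eq add.assoc)
  have xZ2: "x ! (A' + db + k) \<in> Z" if "k \<le> m" for k
    using xb(5)[OF that] x[of "m + da + 2 * N + db + k"] by (simp add: A'_eq add.assoc)
  have g_nonneg: "g t i j \<ge> 0" for t i j by (simp add: g_def nonneg)
  have p_le: "p i j \<le> pmax j" for i j by (simp add: pmax_def)
  have g_le: "g t i j \<le> f j (x ! t) * pmax j" for t i j
    unfolding g_def mult.commute[of "p i j"] by (intro mult_left_mono p_le nonneg)
  have g_le_K: "g t i j \<le> K" if "f j (x ! t) \<le> K" for t i j
    using mult_mono[OF p_le_1 that] nonneg by (simp add: g_def)
  have g_cyc: "g t (cyc (t - 1 - A)) (cyc (t - A)) = f (cyc (t - A)) (x ! t) * pmax (cyc (t - A))"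
    if "A < t" "t \<le> A'" for t
  proof -
    obtain k where k: "t = A + Suc k" using \<open>A < t\<close> less_iff_Suc_add by auto
    then show ?thesis using cyc[of k] that by (simp add: A'_def U_def g_def)
  qed
  have gap: "g t i j \<le> \<rho> * g t (cyc (t - 1 - A)) (cyc (t - A))"
    if t: "A < t" "t \<le> A'" and j: "j \<noteq> cyc (t - A)" for t i j
  proof -
    have "x ! t \<in> D (cyc (t - A))" using xc[of "t - A"] t by (simp add: A'_def U_def)
    from order.trans[OF g_le D(3)[OF this j]] show ?thesis unfolding g_cyc[OF t] .
  qed
  have dom: "g t i j \<le> g t (cyc (t - 1 - A)) (cyc (t - A))" if t: "A < t" "t \<le> A'" for t i j
  proof (cases "j = cyc (t - A)")
    case True
    then show ?thesis unfolding g_cyc[OF t] using g_le[of t i j] by simp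
  next
    case False
    note gap[OF t False]
    also have "\<rho> * g t (cyc (t - 1 - A)) (cyc (t - A)) \<le> g t (cyc (t - 1 - A)) (cyc (t - A))"
      using rho g_nonneg by (simp add: mult_left_le_one_le)
    finally show ?thesis .
  qed
  have bound1: "f i (x ! t) \<le> K" if "w < t" "t \<le> A" for t i
  proof (cases "t \<le> w + m")
    case True
    then show ?thesis using Z(3)[OF xZ1[of "t - w"]] that by simp
  next
    case False
    then show ?thesis using D(2)[OF xa[of "t - (w + m)"]] that by (simp add: A_def)
  qed
  have bound2: "f i (x ! t) \<le> K" if "A' < t" "t \<le> e" for t i
  proof (cases "t < A' + db")
    case True
    then show ?thesis using D(2)[OF xb'[of "t - A'"]] that by simp
  next
    case False
    then show ?thesis using Z(3)[OF xZ2[of "t - (A' + db)"]] that by (simp add: e_def)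
  qed
  let ?V = "\<lambda>Q. \<pi> (Q 0) * f (Q 0) (x ! 0) * path_weight g 0 e Q"
  have V_nonneg: "?V Q \<ge> 0" for Q
    by (intro mult_nonneg_nonneg nonneg path_weight_nonneg g_nonneg)
  have in_C: "Q t \<in> C" if V: "?V Q \<noteq> 0" and t: "0 < t" "t \<le> e" "x ! t \<in> Z" for Q t
  proof (rule ccontr)
    assume "Q t \<notin> C"
    then have "g t (Q (t - 1)) (Q t) = 0" using Z(2) t by (simp add: g_def)
    then have "path_weight g 0 e Q = 0" using t by (auto simp: path_weight_def intro!: prod_zero)
    then show False using V by simp
  qed
  have u: "w + length xb - (N + db + m) = Suc U" "Suc U + (N + db + m) = Suc e"
    by (simp_all add: len e_def A'_def U_def A_def)
  have "is_node \<pi> p f x (N + db + m) (Suc U) (cyc N)"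
  proof (rule is_nodeI[OF nonneg])
    show "1 \<le> Suc U" "Suc U + (N + db + m) \<le> length x"
      by (simp_all add: x_def len w_def[symmetric] e_def A'_def U_def A_def)
    fix Q :: "nat \<Rightarrow> 's" and j
    have "\<exists>Q'. Q' U = cyc N \<and> ?V Q * p (Q e) j \<le> ?V Q' * p (Q' e) j"
    proof (cases "?V Q = 0")
      case True
      have "?V (\<lambda>_. cyc N) * p (cyc N) j \<ge> 0" by (intro mult_nonneg_nonneg V_nonneg nonneg)
      then show ?thesis unfolding True by (intro exI[of _ "\<lambda>_. cyc N"]) (simp only: mult_zero_left simp_thms)
    next
      case False
      have "Q w \<in> C" using in_C[OF False, of w] xZ1[of 0] w0
        by (simp add: w_def e_def A'_def U_def A_def)
      then obtain z where z: "z 0 = Q w" "z m = c0" "positive_path p m z" "\<And>t. t \<le> m \<Longrightarrow> z t \<in> C"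
        using cl by metis
      have "Q e \<in> C" using in_C[OF False, of e] xZ2[of m] w0
        by (simp add: w_def e_def A'_def U_def A_def)
      then obtain y where y: "y 0 = c0" "y m = Q e" "positive_path p m y" "\<And>t. t \<le> m \<Longrightarrow> y t \<in> C"
        using cl by metis
      \<comment> \<open>The replacement starts where \<open>Q\<close> enters the block and ends where \<open>Q\<close> leaves it, so
        everything outside the block, including the transition into \<open>j\<close>, is unchanged.\<close>
      let ?in = "path_join m z a" and ?out = "path_join db b y"
      have pin: "positive_path p (m + da) ?in"
        by (intro positive_path_join z a) (simp add: z a)
      have pout: "positive_path p (db + m) ?out"
        by (intro positive_path_join y b) (simp add: y b)
      have em_in: "\<eta> \<le> f (?in k) (x ! (w + k))" if k: "0 < k" "k \<le> m + da" for k
      proof (cases "k \<le> m")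
        case True
        then show ?thesis using Z(1)[OF xZ1 z(4)] by (simp add: path_join_left)
      next
        case False
        then obtain d where d: "k = m + d" "0 < d"
          by (metis less_imp_add_positive not_le)
        then show ?thesis
          using D(1)[OF xa[of d]] k path_join_right[of z m a d] z(2) a(2) by (simp add: add.assoc)
      qed
      have em_out: "\<eta> \<le> f (?out k) (x ! (A' + k))" if k: "0 < k" "k \<le> db + m" for k
      proof (cases "k < db")
        case True
        then show ?thesis using D(1)[OF xb'] k by (simp add: path_join_left)
      next
        case False
        then obtain d where d: "k = db + d"
          by (metis le_add_diff_inverse not_less)
        then show ?thesis
          using Z(1)[OF xZ2 y(4), of d] k path_join_right[of b db y d] b(3) y(1)
          by (simp add: add.assoc)
      qed
      obtain Q' where Q': "Q' U = cyc (U - A)" "\<And>t. t \<le> w \<or> e \<le> t \<Longrightarrow> Q' t = Q t"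
        "path_weight g w e Q \<le> path_weight g w e Q'"
      proof (rule reroute_through_centre[of g w A N U A' e \<rho> "\<eta> * \<eta>" K "\<lambda>t. cyc (t - A)"
            "\<lambda>t. ?in (t - w)" Q "\<lambda>t. ?out (t - A')"])
        show "w \<le> A" "A + N \<le> U" "U + N \<le> A'" "A' \<le> e"
          by (simp_all add: A_def U_def A'_def e_def)
        show "?in (w - w) = Q w" by (simp add: path_join_left z)
        show "?in (A - w) = cyc (A - A)"
          using path_join_right[of z m a da] z a by (simp add: A_def)
        show "?out (A' - A') = cyc (A' - A)"
          using b by (simp add: path_join_left A'_def U_def mult_2)
        show "?out (e - A') = Q e"
          using path_join_right[of b db y m] y b by (simp add: e_def)
        show "\<eta> * \<eta> \<le> g t (?in (t - 1 - w)) (?in (t - w))" if "w < t" "t \<le> A" for t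
          unfolding g_def
          by (rule positive_path_step_ge[of p "m + da" "?in" \<eta> f x "w"])
            (use pin eta em_in that in \<open>simp_all add: A_def\<close>)
        show "\<eta> * \<eta> \<le> g t (?out (t - 1 - A')) (?out (t - A'))" if "A' < t" "t \<le> e" for t
          unfolding g_def
          by (rule positive_path_step_ge[of p "db + m" "?out" \<eta> f x "A'"])
            (use pout eta em_out that in \<open>simp_all add: e_def\<close>)
        show "K ^ (A - w) * K ^ (e - A') * \<rho> ^ N \<le> (\<eta> * \<eta>) ^ (A - w) * (\<eta> * \<eta>) ^ (e - A')"
          using small by (simp add: A_def e_def)
      qed (use g_nonneg rho K eta dom gap g_le_K bound1 bound2 in auto)
      have split: "path_weight g 0 e r = path_weight g 0 w r * path_weight g w e r" for r
        by (rule path_weight_split) (simp_all add: e_def A'_def U_def A_def)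
      have "path_weight g 0 w Q' = path_weight g 0 w Q"
        by (rule path_weight_cong) (simp add: Q'(2))
      then have "path_weight g 0 e Q \<le> path_weight g 0 e Q'"
        unfolding split using Q'(3) by (simp add: mult_left_mono path_weight_nonneg g_nonneg)
      then have "?V Q * p (Q e) j \<le> ?V Q' * p (Q' e) j"
        using Q'(2)[of 0] Q'(2)[of e]
        by (simp, intro mult_right_mono mult_left_mono mult_nonneg_nonneg nonneg)
      then show ?thesis using Q'(1) by (intro exI[of _ Q']) (simp add: U_def)
    qed
    then show "\<exists>Q'. Q' (Suc U - 1) = cyc N \<and>
        \<pi> (Q 0) * f (Q 0) (x ! 0) * path_weight (\<lambda>t i j. p i j * f j (x ! t)) 0 (Suc U + (N + db + m) - 1) Q *
          p (Q (Suc U + (N + db + m) - 1)) j \<le>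
        \<pi> (Q' 0) * f (Q' 0) (x ! 0) * path_weight (\<lambda>t i j. p i j * f j (x ! t)) 0 (Suc U + (N + db + m) - 1) Q' *
          p (Q' (Suc U + (N + db + m) - 1)) j"
      unfolding u by (simp add: g_def[abs_def])
  qed
  then show "is_node \<pi> p f (x' @ xb) (N + db + m) (length x' + length xb - (N + db + m)) (cyc N)"
    using u by (simp add: x_def w_def)
qed

section \<open>Positive paths, cylinder sets and limits\<close>

lemma submatrix_power_path:
  assumes "\<And>i j. p i j \<ge> 0" "i \<in> A" "submatrix_power p A n i j \<noteq> 0"
  shows "\<exists>z. z 0 = i \<and> z n = j \<and> positive_path p n z \<and> (\<forall>t\<le>n. z t \<in> A)"
  using assms(2,3)
proof (induction n arbitrary: i)
  case 0
  then show ?case by (intro exI[of _ "\<lambda>_. i"]) (auto simp: positive_path_def split: if_splits)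
next
  case (Suc n)
  from Suc.prems(2) obtain k where k: "k \<in> A" "p i k * submatrix_power p A n k j \<noteq> 0"
    by (auto elim: sum.not_neutral_contains_not_neutral)
  with Suc.IH obtain z where z: "z 0 = k" "z n = j" "positive_path p n z" "\<forall>t\<le>n. z t \<in> A"
    by (metis mult_zero_right)
  have "p i k > 0" using k assms(1)[of i k] by (simp add: less_le)
  then have "positive_path p (Suc n) (case_nat i z)"
    using z unfolding positive_path_def by (auto split: nat.split simp: less_Suc_eq_0_disj)
  then show ?case
    using z Suc.prems(1) by (intro exI[of _ "case_nat i z"]) (auto split: nat.split)
qed

text \<open>
  The length is made positive by taking one step first, since irreducibility itself may return
  the empty path when \<open>i = j\<close>.
\<close>

lemma irreducible_connect:
  assumes "irreducible_matrix p" "\<And>i j. p i j \<ge> 0" "\<And>i. (\<Sum>j\<in>UNIV. p i j) = 1"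
  shows "\<exists>n z. 0 < n \<and> z 0 = i \<and> z n = j \<and> positive_path p n z"
proof -
  obtain k where k: "p i k > 0"
    using assms(2,3)[of i] by (metis less_le sum.neutral zero_neq_one)
  obtain n where "submatrix_power p UNIV n k j > 0"
    using assms(1) by (auto simp: irreducible_matrix_def)
  then obtain z where z: "z 0 = k" "z n = j" "positive_path p n z"
    using submatrix_power_path[of p k UNIV n j] assms(2) by auto
  have "positive_path p 1 (case_nat i z)" using k z by (simp add: positive_path_def)
  from positive_path_join[OF this z(3)] show ?thesis
    by (intro exI[of _ "Suc n"] exI[of _ "path_join 1 (case_nat i z) z"])
      (use z in \<open>auto simp: path_join_def\<close>)
qed

lemma in_listset_iff: "y \<in> listset Bs \<longleftrightarrow> length y = length Bs \<and> (\<forall>k<length Bs. y ! k \<in> Bs ! k)"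
proof (induction Bs arbitrary: y)
  case (Cons B Bs)
  then show ?case
    by (cases y) (auto simp: set_Cons_def nth_Cons less_Suc_eq_0_disj split: nat.splits)
qed simp

lemma periodic_point:
  fixes s :: "'s::finite \<Rightarrow> 's"
  shows "\<exists>l L. 0 < L \<and> (s ^^ L) l = l"
proof -
  have "\<not> inj (\<lambda>n. (s ^^ n) undefined)"
    using finite_imageD[of "\<lambda>n. (s ^^ n) undefined" UNIV] infinite_UNIV_nat by auto
  then obtain a b where ab: "a < b" "(s ^^ a) undefined = (s ^^ b) undefined"
    by (metis (mono_tags, lifting) injI linorder_neqE_nat)
  have "(s ^^ (b - a)) ((s ^^ a) undefined) = (s ^^ b) undefined"
    using ab(1) by (metis comp_apply funpow_add le_add_diff_inverse2 less_imp_le)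
  with ab show ?thesis by (intro exI[of _ "(s ^^ a) undefined"] exI[of _ "b - a"]) simp
qed

lemma (in finite_measure) eventually_measure_pos:
  assumes "range A \<subseteq> sets M" "incseq A" "measure M S > 0"
    and ae: "AE x in M. x \<in> S \<longrightarrow> (\<exists>n. x \<in> A n)"
  shows "eventually (\<lambda>n. measure M (A n) > 0) sequentially"
proof -
  have "measure M S \<le> measure M (\<Union>n. A n)"
    using ae assms(1) by (intro finite_measure_mono_AE) auto
  with assms have "measure M (\<Union>n. A n) > 0" by linarith
  from order_tendstoD(1)[OF finite_Lim_measure_incseq[OF assms(1,2)] this] show ?thesis .
qed

lemma eventually_inverse_le:
  fixes a :: real assumes "a > 0"
  shows "eventually (\<lambda>n. inverse (real (Suc n)) \<le> a) sequentially"
  using order_tendstoD(2)[OF LIMSEQ_inverse_real_of_nat assms] by eventually_elim simp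

lemma eventually_le_real: "eventually (\<lambda>n. a \<le> real n) sequentially"
  using filterlim_real_sequentially by (simp add: filterlim_at_top)

section \<open>Finite-dimensional laws of the hidden Markov model\<close>

context hidden_markov_model
begin

lemma AE_density_pos: "AE x in P l. f l x > 0"
  using f_measurable sets_lam measurable_cong_sets[OF sets_lam refl]
  by (subst P_density, subst AE_density) auto

text \<open>
  All the laws have densities with respect to the same measure: a \<open>P i\<close>-null set is a set on
  which \<open>f i\<close> vanishes almost everywhere for \<open>lam\<close>, hence for every \<open>P j\<close>.
\<close>

lemma AE_density_zero:
  assumes G: "G \<in> sets borel" "measure (P i) G = 0"
  shows "AE x in P j. x \<in> G \<longrightarrow> f i x = 0"
proof -
  have meas: "(\<lambda>x. ennreal (f k x)) \<in> borel_measurable lam" for k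
    using f_measurable sets_lam measurable_cong_sets[OF sets_lam refl] by auto
  have sets_P: "sets (P i) = sets borel" using P_density sets_lam by (metis sets_density)
  interpret Pi: prob_space "P i" by (rule prob_space_P)
  have "G \<in> null_sets (P i)"
    using G sets_P by (auto simp: null_sets_def Pi.emeasure_eq_measure)
  then have "AE x in P i. x \<notin> G" by (rule AE_not_in)
  then have "AE x in lam. 0 < f i x \<longrightarrow> x \<notin> G"
    using meas by (subst (asm) P_density, subst (asm) AE_density) auto
  then have "AE x in lam. x \<in> G \<longrightarrow> f i x = 0"
    by eventually_elim (use f_nonneg[of i] in \<open>auto simp: less_le\<close>)
  then show ?thesis
    using meas by (subst P_density, subst AE_density) auto
qed

lemma state_event: "n \<ge> 1 \<Longrightarrow> {\<omega> \<in> space \<Omega>. Y n \<omega> = i} \<in> events"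
  using measurable_sets[OF measurable_Y, of n "{i}"] by (simp add: vimage_def Int_def conj_commute)

lemma observation_event: "n \<ge> 1 \<Longrightarrow> A \<in> sets borel \<Longrightarrow> {\<omega> \<in> space \<Omega>. X n \<omega> \<in> A} \<in> events"
  using measurable_sets[OF measurable_X, of n A] by (simp add: vimage_def Int_def conj_commute)

text \<open>
  Some state has positive stationary mass, and stationarity carries positivity along every
  possible transition.
\<close>

lemma stationary_pos: "\<pi> j > 0"
proof -
  have "1 = prob (\<Union>i\<in>UNIV. {\<omega> \<in> space \<Omega>. Y 1 \<omega> = i})"
  proof -
    have "(\<Union>i\<in>UNIV. {\<omega> \<in> space \<Omega>. Y 1 \<omega> = i}) = space \<Omega>" by auto
    then show ?thesis by (simp only: prob_space)
  qed
  also have "\<dots> \<le> (\<Sum>i\<in>UNIV. prob {\<omega> \<in> space \<Omega>. Y 1 \<omega> = i})"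
    by (intro finite_measure_subadditive_finite) (auto simp del: One_nat_def intro: state_event)
  finally have "(\<Sum>i\<in>UNIV. \<pi> i) \<ge> 1" unfolding initial .
  moreover have nn: "\<pi> i \<ge> 0" for i unfolding initial[symmetric] by (rule measure_nonneg)
  ultimately have "(\<Sum>i\<in>UNIV. \<pi> i) \<noteq> 0" by linarith
  then obtain i where "\<pi> i \<noteq> 0" by (auto elim: sum.not_neutral_contains_not_neutral)
  with nn[of i] have i: "\<pi> i > 0" by linarith
  obtain n z where z: "z 0 = i" "z n = j" "positive_path p n z"
    using irreducible_connect[OF irreducible p_nonneg p_row_sum, of i j] by blast
  have "\<pi> (z t) > 0" if "t \<le> n" for t
    using that
  proof (induction t)
    case (Suc t)
    have "0 < \<pi> (z t) * p (z t) (z (Suc t))"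
      using Suc z(3) by (simp add: positive_path_def)
    also have "\<dots> \<le> (\<Sum>i\<in>UNIV. \<pi> i * p i (z (Suc t)))"
      by (rule member_le_sum) (auto simp: nn p_nonneg)
    finally show ?case by (simp add: stationary)
  qed (simp add: i z)
  from this[of n] z show ?thesis by simp
qed

lemma path_prob_pos:
  assumes "positive_path p n q"
  shows "\<P>(\<omega> in \<Omega>. \<forall>i\<in>{1..Suc n}. Y i \<omega> = q (i - 1)) > 0"
  using assms
proof (induction n)
  case 0
  then show ?case using initial[of "q 0"] stationary_pos[of "q 0"] by simp
next
  case (Suc n)
  let ?E = "\<lambda>\<omega>. \<forall>i\<in>{1..Suc n}. Y i \<omega> = q (i - 1)"
  have pos: "\<P>(\<omega> in \<Omega>. ?E \<omega>) > 0" using Suc by (simp add: positive_path_def)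
  have "\<P>(\<omega> in \<Omega>. Y (Suc (Suc n)) \<omega> = q (Suc n) \<bar> ?E \<omega>) = p (q n) (q (Suc n))"
    using transition[of "Suc n" "\<lambda>i. q (i - 1)"] pos by simp
  also have "\<dots> > 0" using Suc.prems by (simp add: positive_path_def)
  finally have "\<P>(\<omega> in \<Omega>. Y (Suc (Suc n)) \<omega> = q (Suc n) \<and> ?E \<omega>) > 0"
    using pos by (simp add: cond_prob_def zero_less_divide_iff)
  also have "{\<omega> \<in> space \<Omega>. Y (Suc (Suc n)) \<omega> = q (Suc n) \<and> ?E \<omega>} =
      {\<omega> \<in> space \<Omega>. \<forall>i\<in>{1..Suc (Suc n)}. Y i \<omega> = q (i - 1)}"
  proof -
    have "{1..Suc (Suc n)} = insert (Suc (Suc n)) {1..Suc n}" by auto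
    then show ?thesis by simp
  qed
  finally show ?case .
qed

text \<open>
  The product of emission probabilities is constant on the event that fixes \<open>Y\<close>, and this event
  is measurable for \<open>Y\<close>, so integrating the conditional probability over it gives a product.
\<close>

lemma joint_law:
  assumes A: "\<And>i. i \<in> {1..n} \<Longrightarrow> A i \<in> sets borel"
  shows "\<P>(\<omega> in \<Omega>. (\<forall>i\<in>{1..n}. X i \<omega> \<in> A i) \<and> (\<forall>i\<in>{1..n}. Y i \<omega> = q i)) =
    (\<Prod>i=1..n. measure (P (q i)) (A i)) * \<P>(\<omega> in \<Omega>. \<forall>i\<in>{1..n}. Y i \<omega> = q i)"
proof -
  let ?F = "process_sigma \<Omega> Y"
  define D where "D = {\<omega> \<in> space \<Omega>. \<forall>i\<in>{1..n}. X i \<omega> \<in> A i}"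
  define E where "E = {\<omega> \<in> space \<Omega>. \<forall>i\<in>{1..n}. Y i \<omega> = q i}"
  define c where "c = (\<Prod>i=1..n. measure (P (q i)) (A i))"
  have gen: "{Y n -` A \<inter> space \<Omega> |n A. n \<ge> 1} \<subseteq> sets \<Omega>"
    using measurable_Y by (auto intro: measurable_sets)
  have sub: "subalgebra \<Omega> ?F"
    unfolding subalgebra_def process_sigma_def using gen
    by (auto simp: space_measure_of_conv sets_measure_of_conv intro!: sets.sigma_sets_subset)
  interpret F: finite_measure_subalgebra \<Omega> ?F by unfold_locales (rule sub)
  have space_F: "space ?F = space \<Omega>" by (simp add: process_sigma_def space_measure_of_conv)
  have EF: "E \<in> sets ?F"
  proof -
    have "{\<omega> \<in> space ?F. Y i \<omega> = q i} \<in> sets ?F" if "i \<in> {1..n}" for i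
    proof -
      have "Y i -` {q i} \<inter> space \<Omega> \<in> sets ?F"
        unfolding process_sigma_def using that gen sets.space_closed[of \<Omega>]
        by (subst sets_measure_of) (auto intro!: sigma_sets.Basic)
      then show ?thesis by (simp add: space_F vimage_def Int_def conj_commute)
    qed
    then have "{\<omega> \<in> space ?F. \<forall>i\<in>{1..n}. Y i \<omega> = q i} \<in> sets ?F"
      by (intro sets.sets_Collect_finite_All) auto
    then show ?thesis by (simp add: E_def space_F)
  qed
  then have E: "E \<in> sets \<Omega>" using sub by (auto simp: subalgebra_def)
  have D: "D \<in> sets \<Omega>"
    unfolding D_def using A by (intro sets.sets_Collect_finite_All observation_event) auto
  have cond: "AE \<omega> in \<Omega>. real_cond_exp \<Omega> ?F (indicat_real D) \<omega> = (\<Prod>i=1..n. measure (P (Y i \<omega>)) (A i))"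
    unfolding D_def by (rule emission) (rule A)
  have "prob (D \<inter> E) = (\<integral>\<omega>\<in>E. indicat_real D \<omega> \<partial>\<Omega>)"
    using D E by (simp add: set_lebesgue_integral_def Int_commute flip: indicator_inter_arith)
  also have "\<dots> = (\<integral>\<omega>\<in>E. real_cond_exp \<Omega> ?F (indicat_real D) \<omega> \<partial>\<Omega>)"
    using D EF by (intro F.real_cond_exp_intA integrable_real_indicator) (auto simp: emeasure_eq_measure)
  also have "\<dots> = (\<integral>\<omega>. c * indicat_real E \<omega> \<partial>\<Omega>)"
    unfolding set_lebesgue_integral_def
  proof (rule integral_cong_AE)
    show "AE \<omega> in \<Omega>. indicat_real E \<omega> *\<^sub>R real_cond_exp \<Omega> ?F (indicat_real D) \<omega> = c * indicat_real E \<omega>"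
      using cond
    proof eventually_elim
      case (elim \<omega>)
      have "(\<Prod>i=1..n. measure (P (Y i \<omega>)) (A i)) = c" if "\<omega> \<in> E"
        unfolding c_def by (rule prod.cong) (use that in \<open>auto simp: E_def\<close>)
      then show ?case unfolding elim by (auto simp: indicator_def)
    qed
  qed (use E in auto)
  also have "\<dots> = c * prob E" using E by simp
  also have "D \<inter> E = {\<omega> \<in> space \<Omega>. (\<forall>i\<in>{1..n}. X i \<omega> \<in> A i) \<and> (\<forall>i\<in>{1..n}. Y i \<omega> = q i)}"
    by (auto simp: D_def E_def)
  finally show ?thesis by (simp add: c_def E_def)
qed

lemma block_prob_pos:
  assumes path: "positive_path p n q"
    and B: "\<And>k. k \<le> n \<Longrightarrow> B k \<in> sets borel" "\<And>k. k \<le> n \<Longrightarrow> measure (P (q k)) (B k) > 0"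
  shows "\<P>(\<omega> in \<Omega>. map (\<lambda>i. Y i \<omega>) [1..<Suc (Suc n)] = map q [0..<Suc n]) > 0"
    and "\<P>(\<omega> in \<Omega>. map (\<lambda>i. X i \<omega>) [1..<Suc (Suc n)] \<in> listset (map B [0..<Suc n])
      \<bar> map (\<lambda>i. Y i \<omega>) [1..<Suc (Suc n)] = map q [0..<Suc n]) > 0"
proof -
  have shift: "(\<forall>k<Suc n. R (Suc k) k) \<longleftrightarrow> (\<forall>i\<in>{1..Suc n}. R i (i - 1))" for R :: "nat \<Rightarrow> nat \<Rightarrow> bool"
  proof (intro iffI ballI allI impI)
    fix i assume "\<forall>k<Suc n. R (Suc k) k" "i \<in> {1..Suc n}"
    then show "R i (i - 1)" by (cases i) auto
  next
    fix k assume "\<forall>i\<in>{1..Suc n}. R i (i - 1)" "k < Suc n"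
    then show "R (Suc k) k" by (auto dest: bspec[of _ _ "Suc k"])
  qed
  have Y_eq: "map (\<lambda>i. Y i \<omega>) [1..<Suc (Suc n)] = map q [0..<Suc n] \<longleftrightarrow>
      (\<forall>i\<in>{1..Suc n}. Y i \<omega> = q (i - 1))" for \<omega>
    unfolding shift[of "\<lambda>i k. Y i \<omega> = q k", symmetric] list_eq_iff_nth_eq
    by (auto simp del: upt_Suc)
  have X_in: "map (\<lambda>i. X i \<omega>) [1..<Suc (Suc n)] \<in> listset (map B [0..<Suc n]) \<longleftrightarrow>
      (\<forall>i\<in>{1..Suc n}. X i \<omega> \<in> B (i - 1))" for \<omega>
    unfolding shift[of "\<lambda>i k. X i \<omega> \<in> B k", symmetric] in_listset_iff
    by (auto simp del: upt_Suc)
  have Y_pos: "\<P>(\<omega> in \<Omega>. \<forall>i\<in>{1..Suc n}. Y i \<omega> = q (i - 1)) > 0"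
    by (rule path_prob_pos[OF path])
  then show "\<P>(\<omega> in \<Omega>. map (\<lambda>i. Y i \<omega>) [1..<Suc (Suc n)] = map q [0..<Suc n]) > 0"
    unfolding Y_eq .
  have "(\<Prod>i=1..Suc n. measure (P (q (i - 1))) (B (i - 1))) > 0"
    by (rule prod_pos) (use B(2) in auto)
  then have "\<P>(\<omega> in \<Omega>. (\<forall>i\<in>{1..Suc n}. X i \<omega> \<in> B (i - 1)) \<and> (\<forall>i\<in>{1..Suc n}. Y i \<omega> = q (i - 1))) > 0"
    using Y_pos B(1) by (subst joint_law) (auto simp del: prod.cl_ivl_Suc)
  then show "\<P>(\<omega> in \<Omega>. map (\<lambda>i. X i \<omega>) [1..<Suc (Suc n)] \<in> listset (map B [0..<Suc n])
      \<bar> map (\<lambda>i. Y i \<omega>) [1..<Suc (Suc n)] = map q [0..<Suc n]) > 0"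
    unfolding cond_prob_def Y_eq X_in using Y_pos by (rule divide_pos_pos)
qed

section \<open>Observation sets of positive probability\<close>

definition column_max :: "'s \<Rightarrow> real" where
  "column_max j = Max (range (\<lambda>i. p i j))"

lemma column_max_ge: "p i j \<le> column_max j"
  by (simp add: column_max_def)

lemma column_max_nonneg: "column_max j \<ge> 0"
  using p_nonneg column_max_ge order.trans by blast

text \<open>
  A single index \<open>n\<close> controls the lower bound, the upper bound and the gap, so that the sets
  increase with \<open>n\<close> and one value of \<open>n\<close> can serve all states at once.
\<close>

definition dominance_set :: "nat \<Rightarrow> 's \<Rightarrow> 'x set" where
  "dominance_set n l = {x. inverse (real (Suc n)) \<le> f l x \<and> (\<forall>i. f i x \<le> real n) \<and>
     (\<forall>i. i \<noteq> l \<longrightarrow> f i x * column_max i \<le> (1 - inverse (real (Suc n))) * (f l x * column_max l))}"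

definition cluster_set :: "'s set \<Rightarrow> nat \<Rightarrow> 'x set" where
  "cluster_set C n = {x \<in> (\<Inter>i\<in>C. measure_support (P i)).
     (\<forall>i\<in>C. inverse (real (Suc n)) \<le> f i x) \<and> (\<forall>i. f i x \<le> real n) \<and> (\<forall>i. i \<notin> C \<longrightarrow> f i x = 0)}"

lemma sets_P: "sets (P l) = sets borel"
  using P_density sets_lam by (metis sets_density)

lemma support_borel: "(\<Inter>i\<in>C. measure_support (P i)) \<in> sets borel"
  by (intro borel_closed closed_INT) (auto simp: measure_support_def intro!: closed_Inter)

lemma dominance_set_borel: "dominance_set n l \<in> sets borel"
proof -
  have [measurable]: "f i \<in> borel_measurable borel" for i by (rule f_measurable)
  show ?thesis unfolding dominance_set_def by measurable
qed

lemma cluster_set_borel: "cluster_set C n \<in> sets borel"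
proof -
  have [measurable]: "f i \<in> borel_measurable borel" for i by (rule f_measurable)
  have "cluster_set C n = (\<Inter>i\<in>C. measure_support (P i)) \<inter>
     {x. (\<forall>i. i \<in> C \<longrightarrow> inverse (real (Suc n)) \<le> f i x) \<and> (\<forall>i. f i x \<le> real n) \<and> (\<forall>i. i \<notin> C \<longrightarrow> f i x = 0)}"
    by (auto simp: cluster_set_def)
  moreover have "{x. (\<forall>i. i \<in> C \<longrightarrow> inverse (real (Suc n)) \<le> f i x) \<and> (\<forall>i. f i x \<le> real n) \<and>
      (\<forall>i. i \<notin> C \<longrightarrow> f i x = 0)} \<in> sets borel"
    by measurable
  ultimately show ?thesis using support_borel by auto
qed

lemma incseq_dominance_set: "incseq (\<lambda>n. dominance_set n l)"
proof (rule monoI, rule subsetI)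
  fix k n :: nat and x assume kn: "k \<le> n" and x: "x \<in> dominance_set k l"
  have inv: "inverse (real (Suc n)) \<le> inverse (real (Suc k))"
    using kn by (intro le_imp_inverse_le) auto
  have gap: "(1 - inverse (real (Suc k))) * (f l x * column_max l) \<le> (1 - inverse (real (Suc n))) * (f l x * column_max l)"
    using inv by (intro mult_right_mono mult_nonneg_nonneg f_nonneg column_max_nonneg) auto
  show "x \<in> dominance_set n l"
    using x kn unfolding dominance_set_def
    by (auto intro: order.trans[OF inv] order.trans[of _ "real k"] order.trans[OF _ gap] simp del: of_nat_Suc)
qed

lemma incseq_cluster_set: "incseq (cluster_set C)"
proof (rule monoI, rule subsetI)
  fix k n :: nat and x assume kn: "k \<le> n" and x: "x \<in> cluster_set C k"
  have inv: "inverse (real (Suc n)) \<le> inverse (real (Suc k))"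
    using kn by (intro le_imp_inverse_le) auto
  show "x \<in> cluster_set C n"
    using x kn unfolding cluster_set_def
    by (auto intro: order.trans[OF inv] order.trans[of _ "real k"] simp del: of_nat_Suc)
qed

text \<open>
  The sets increase to the set where \<open>l\<close> is strictly dominant and \<open>f l\<close> is positive, and the
  second condition holds almost surely for \<open>P l\<close>; continuity from below does the rest.
\<close>

lemma eventually_dominance_set_pos:
  assumes "measure (P l) {x. \<forall>i. i \<noteq> l \<longrightarrow> f l x * column_max l > f i x * column_max i} > 0"
  shows "eventually (\<lambda>n. measure (P l) (dominance_set n l) > 0) sequentially"
proof -
  interpret Pl: prob_space "P l" by (rule prob_space_P)
  let ?S = "{x. \<forall>i. i \<noteq> l \<longrightarrow> f l x * column_max l > f i x * column_max i}"
  have mem: "\<exists>n. x \<in> dominance_set n l" if x: "x \<in> ?S" "f l x > 0" for x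
  proof -
    have 1: "eventually (\<lambda>n. inverse (real (Suc n)) \<le> f l x) sequentially"
      by (rule eventually_inverse_le[OF x(2)])
    have 2: "eventually (\<lambda>n. \<forall>i. f i x \<le> real n) sequentially"
      by (intro eventually_all_finite eventually_le_real)
    have 3: "eventually (\<lambda>n. \<forall>i. i \<noteq> l \<longrightarrow>
        f i x * column_max i \<le> (1 - inverse (real (Suc n))) * (f l x * column_max l)) sequentially"
    proof (intro eventually_all_finite)
      fix i
      have lim: "(\<lambda>n. (1 - inverse (real (Suc n))) * (f l x * column_max l)) \<longlonglongrightarrow> (1 - 0) * (f l x * column_max l)"
        by (intro tendsto_intros LIMSEQ_inverse_real_of_nat)
      show "eventually (\<lambda>n. i \<noteq> l \<longrightarrow>
          f i x * column_max i \<le> (1 - inverse (real (Suc n))) * (f l x * column_max l)) sequentially"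
      proof (cases "i = l")
        case False
        then have "f i x * column_max i < (1 - 0) * (f l x * column_max l)" using x by simp
        from order_tendstoD(1)[OF lim this] show ?thesis by eventually_elim simp
      qed simp
    qed
    from eventually_conj[OF 1 eventually_conj[OF 2 3]] show ?thesis
      unfolding dominance_set_def using eventually_happens'[OF sequentially_bot] by fastforce
  qed
  show ?thesis
  proof (rule Pl.eventually_measure_pos[OF _ incseq_dominance_set assms])
    show "range (\<lambda>n. dominance_set n l) \<subseteq> sets (P l)"
      using dominance_set_borel by (auto simp: sets_P)
    show "AE x in P l. x \<in> ?S \<longrightarrow> (\<exists>n. x \<in> dominance_set n l)"
      using AE_density_pos[of l] by eventually_elim (use mem in blast)
  qed
qed

text \<open>
  A state outside the cluster gives no mass to the intersection of the supports, so its density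
  vanishes there almost surely for \<open>P j\<close>; the requirement that the other densities are zero
  therefore costs nothing.
\<close>

lemma eventually_cluster_set_pos:
  assumes C: "cluster P f C" and j: "j \<in> C"
  shows "eventually (\<lambda>n. measure (P j) (cluster_set C n) > 0) sequentially"
proof -
  interpret Pj: prob_space "P j" by (rule prob_space_P)
  let ?S = "\<Inter>i\<in>C. measure_support (P i) \<inter> {x. f i x > 0}"
  let ?G = "\<Inter>i\<in>C. measure_support (P i)"
  have mem: "\<exists>n. x \<in> cluster_set C n" if x: "x \<in> ?S" "\<forall>i. i \<notin> C \<longrightarrow> f i x = 0" for x
  proof -
    have 1: "eventually (\<lambda>n. \<forall>i. i \<in> C \<longrightarrow> inverse (real (Suc n)) \<le> f i x) sequentially"
    proof (intro eventually_all_finite)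
      fix i
      show "eventually (\<lambda>n. i \<in> C \<longrightarrow> inverse (real (Suc n)) \<le> f i x) sequentially"
      proof (cases "i \<in> C")
        case True
        then have "f i x > 0" using x by auto
        from eventually_inverse_le[OF this] show ?thesis by eventually_elim simp
      qed simp
    qed
    have 2: "eventually (\<lambda>n. \<forall>i. f i x \<le> real n) sequentially"
      by (intro eventually_all_finite eventually_le_real)
    obtain n where "\<forall>i. i \<in> C \<longrightarrow> inverse (real (Suc n)) \<le> f i x" "\<forall>i. f i x \<le> real n"
      using eventually_happens'[OF sequentially_bot eventually_conj[OF 1 2]] by blast
    then have "x \<in> cluster_set C n" using x unfolding cluster_set_def by blast
    then show ?thesis ..
  qed
  have pos: "measure (P j) ?S > 0"
  proof -
    have "finite C" by simp
    then have "Min ((\<lambda>j. measure (P j) ?S) ` C) \<le> measure (P j) ?S"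
      using j by (intro Min_le) auto
    moreover have "Min ((\<lambda>j. measure (P j) ?S) ` C) > 0" using C unfolding cluster_def by blast
    ultimately show ?thesis by linarith
  qed
  have outside: "AE x in P j. x \<in> ?G \<longrightarrow> f i x = 0" if "i \<notin> C" for i
    using C that unfolding cluster_def by (intro AE_density_zero support_borel) blast
  have zero: "AE x in P j. \<forall>i. i \<notin> C \<longrightarrow> x \<in> ?G \<longrightarrow> f i x = 0"
  proof (subst AE_all_countable, intro allI)
    show "AE x in P j. i \<notin> C \<longrightarrow> x \<in> ?G \<longrightarrow> f i x = 0" for i
      using outside[of i] by (cases "i \<in> C") auto
  qed
  show ?thesis
  proof (rule Pj.eventually_measure_pos[OF _ incseq_cluster_set pos])
    show "range (cluster_set C) \<subseteq> sets (P j)"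
      using cluster_set_borel by (auto simp: sets_P)
    show "AE x in P j. x \<in> ?S \<longrightarrow> (\<exists>n. x \<in> cluster_set C n)"
      using zero
    proof eventually_elim
      case (elim x)
      show ?case
      proof
        assume "x \<in> ?S"
        then show "\<exists>n. x \<in> cluster_set C n" using mem[of x] elim by blast
      qed
    qed
  qed
qed

section \<open>Construction of the barrier\<close>

text \<open>
  The map that sends a state to a best predecessor has a periodic point \<open>l\<close>; its iterates, read
  backwards in time from \<open>l\<close>, give the dominant path. Periodicity makes that path start, pass
  its middle and end in the same \<open>l\<close> for every \<open>N\<close>, so the routes between it and the cluster,
  and with them the constants that \<open>N\<close> has to beat, do not depend on \<open>N\<close>.
\<close>

lemma column_max_cycle:
  obtains l L cyc where "0 < L"
    "\<And>N t. t < 2 * (L * N) \<Longrightarrow> p (cyc N t) (cyc N (Suc t)) = column_max (cyc N (Suc t))"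
    "\<And>N. cyc N 0 = l" "\<And>N. cyc N (L * N) = l" "\<And>N. cyc N (2 * (L * N)) = l"
proof -
  have "column_max j \<in> range (\<lambda>i. p i j)" for j
    unfolding column_max_def by (rule Max_in) auto
  then have "\<exists>i. p i j = column_max j" for j by (metis rangeE)
  then obtain s where s: "p (s j) j = column_max j" for j by metis
  obtain l L where L: "0 < L" "(s ^^ L) l = l" using periodic_point[of s] by blast
  have per: "(s ^^ (L * n)) l = l" for n
    by (induction n) (simp_all add: funpow_add L)
  define cyc where "cyc N t = (s ^^ (2 * (L * N) - t)) l" for N t
  show thesis
  proof (rule that[of L cyc l])
    fix N t assume "t < 2 * (L * N)"
    then have "2 * (L * N) - t = Suc (2 * (L * N) - Suc t)" by simp
    then show "p (cyc N t) (cyc N (Suc t)) = column_max (cyc N (Suc t))"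
      unfolding cyc_def by (simp add: s)
  next
    fix N
    have "2 * (L * N) = L * (2 * N)" "2 * (L * N) - L * N = L * N" by simp_all
    then show "cyc N 0 = l" "cyc N (L * N) = l" unfolding cyc_def by (simp_all only: per diff_zero)
  qed (simp_all add: L cyc_def)
qed

lemma column_max_pos: "column_max j > 0"
proof -
  obtain n z where z: "0 < n" "z n = j" "positive_path p n z"
    using irreducible_connect[OF irreducible p_nonneg p_row_sum, of j j] by blast
  then have "p (z (n - 1)) j > 0"
    unfolding positive_path_def by (metis Suc_pred' diff_less zero_less_one)
  then show ?thesis using column_max_ge[of "z (n - 1)" j] by linarith
qed

lemma transition_le_1: "p i j \<le> 1"
  using member_le_sum[of j UNIV "p i"] p_nonneg p_row_sum by simp

lemma transition_lower_bound:
  obtains \<epsilon> where "\<epsilon> > 0" "\<And>i j. p i j > 0 \<Longrightarrow> p i j \<ge> \<epsilon>"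
proof -
  let ?S = "insert 1 {y \<in> range (\<lambda>(i, j). p i j). y > 0}"
  have fin: "finite ?S" by simp
  show thesis
  proof (rule that[of "Min ?S"])
    show "Min ?S > 0" using fin by (subst Min_gr_iff) auto
    show "p i j \<ge> Min ?S" if "p i j > 0" for i j
      by (rule Min_le[OF fin]) (use that in \<open>auto intro!: image_eqI[of _ _ "(i, j)"]\<close>)
  qed
qed

text \<open>
  Order of the choices: the observation sets and the transition matrix fix the bounds \<open>K\<close>, \<open>\<eta>\<close>
  and the gap; the states \<open>c0\<close> and \<open>l\<close> fix the two connecting paths; only then is the number of
  turns around the cycle chosen, large enough to beat the constants collected so far. The block
  covers the times \<open>0, \<dots>, n\<close>, so its length is \<open>Suc n\<close>.
\<close>

lemma barrier_exists:
  assumes dominance: "\<And>l. measure (P l) {x. \<forall>i. i \<noteq> l \<longrightarrow>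
      f l x * column_max l > f i x * column_max i} > 0"
    and C: "cluster P f C" and m: "\<And>i j. i \<in> C \<Longrightarrow> j \<in> C \<Longrightarrow> submatrix_power p C m i j \<noteq> 0"
  shows "\<exists>n r B q l. r \<le> n \<and> (\<forall>k. B k \<in> sets borel) \<and>
    (\<forall>y \<in> listset (map B [0..<Suc n]). is_barrier \<pi> p f r l y) \<and> q (n - r) = l \<and>
    positive_path p n q \<and> (\<forall>k\<le>n. measure (P (q k)) (B k) > 0)"
proof -
  have "eventually (\<lambda>n. (\<forall>l. measure (P l) (dominance_set n l) > 0) \<and>
      (\<forall>j. j \<in> C \<longrightarrow> measure (P j) (cluster_set C n) > 0)) sequentially"
    using eventually_dominance_set_pos[OF dominance] eventually_cluster_set_pos[OF C]
    by (intro eventually_conj eventually_all_finite) (auto intro: eventually_mono)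
  then obtain n0 where D_pos: "\<And>l. measure (P l) (dominance_set n0 l) > 0"
    and Z_pos: "\<And>j. j \<in> C \<Longrightarrow> measure (P j) (cluster_set C n0) > 0"
    using eventually_happens'[OF sequentially_bot] by blast
  define \<delta> where "\<delta> = inverse (real (Suc n0))"
  have \<delta>: "0 < \<delta>" "\<delta> \<le> 1" unfolding \<delta>_def by (auto simp: inverse_le_1_iff)
  obtain \<epsilon> where \<epsilon>: "\<epsilon> > 0" "\<And>i j. p i j > 0 \<Longrightarrow> p i j \<ge> \<epsilon>"
    using transition_lower_bound by metis
  define \<eta> where "\<eta> = min \<epsilon> \<delta>"
  have \<eta>: "0 < \<eta>" "\<eta> \<le> \<epsilon>" "\<eta> \<le> \<delta>" using \<delta> \<epsilon> by (simp_all add: \<eta>_def)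
  obtain c0 where c0: "c0 \<in> C" using C by (auto simp: cluster_def)
  have conn: "\<exists>z. z 0 = s \<and> z m = s' \<and> positive_path p m z \<and> (\<forall>t\<le>m. z t \<in> C)"
    if "s \<in> C" "s' \<in> C" for s s'
    using submatrix_power_path[OF p_nonneg that(1) m[OF that]] .
  obtain z0 where z0: "z0 0 = c0" "z0 m = c0" "positive_path p m z0" "\<And>t. t \<le> m \<Longrightarrow> z0 t \<in> C"
    using conn[OF c0 c0] by blast
  obtain l L cycN where cycN: "0 < L"
    "\<And>N t. t < 2 * (L * N) \<Longrightarrow> p (cycN N t) (cycN N (Suc t)) = column_max (cycN N (Suc t))"
    "\<And>N. cycN N 0 = l" "\<And>N. cycN N (L * N) = l" "\<And>N. cycN N (2 * (L * N)) = l"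
    by (rule column_max_cycle) blast
  obtain da a where a: "a 0 = c0" "a da = l" "positive_path p da a"
    using irreducible_connect[OF irreducible p_nonneg p_row_sum, of c0 l] by blast
  obtain db b where b: "0 < db" "b 0 = l" "b db = c0" "positive_path p db b"
    using irreducible_connect[OF irreducible p_nonneg p_row_sum, of l c0] by blast
  let ?K = "real n0 + 1" and ?h = "(\<eta> * \<eta>) ^ (m + da) * (\<eta> * \<eta>) ^ (db + m)"
  have K: "?K ^ (m + da) * ?K ^ (db + m) > 0" by simp
  \<comment> \<open>\<open>N0\<close> turns of a cycle of length \<open>L \<ge> 1\<close> give \<open>N = L * N0 \<ge> N0\<close> steps.\<close>
  obtain N0 where "(1 - \<delta>) ^ N0 < ?h / (?K ^ (m + da) * ?K ^ (db + m))"
    using real_arch_pow_inv[of "?h / (?K ^ (m + da) * ?K ^ (db + m))" "1 - \<delta>"] \<delta> \<eta> K by auto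
  then have N0: "?K ^ (m + da) * ?K ^ (db + m) * (1 - \<delta>) ^ N0 \<le> ?h"
    unfolding pos_less_divide_eq[OF K] by (simp only: mult.commute less_imp_le)
  define N where "N = L * N0"
  define cyc where "cyc = cycN N0"
  have cyc: "\<And>t. t < 2 * N \<Longrightarrow> p (cyc t) (cyc (Suc t)) = column_max (cyc (Suc t))"
    "cyc 0 = l" "cyc N = l" "cyc (2 * N) = l"
    using cycN by (simp_all add: N_def cyc_def)
  have "(1 - \<delta>) ^ N \<le> (1 - \<delta>) ^ N0"
    using \<delta> cycN(1) by (intro power_decreasing) (auto simp: N_def)
  then have small: "?K ^ (m + da) * ?K ^ (db + m) * (1 - \<delta>) ^ N \<le> ?h"
    using K N0 by (meson mult_left_mono less_imp_le order.trans)
  have cyc_pos: "positive_path p (2 * N) cyc"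
    unfolding positive_path_def using cyc(1) column_max_pos by simp
  \<comment> \<open>The states of the block, assembled from the back: \<open>r3\<close> is the exit route followed by a path in the cluster,
    \<open>r2\<close> prepends the cycle, \<open>r1\<close> the entry route, and \<open>q\<close> the first path in the cluster.\<close>
  define r3 where "r3 = path_join db b z0"
  define r2 where "r2 = path_join (2 * N) cyc r3"
  define r1 where "r1 = path_join da a r2"
  define q where "q = path_join m z0 r1"
  have r3: "r3 0 = cyc (2 * N)" "positive_path p (db + m) r3"
    unfolding r3_def using b z0 cyc by (auto simp: path_join_left intro!: positive_path_join)
  have r2: "r2 0 = a da" "positive_path p (2 * N + (db + m)) r2"
    unfolding r2_def using r3 cyc cyc_pos a by (auto simp: path_join_left intro!: positive_path_join)
  have r1: "r1 0 = z0 m" "positive_path p (da + (2 * N + (db + m))) r1"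
    unfolding r1_def using r2 z0 a by (auto simp: path_join_left intro!: positive_path_join)
  define n where "n = m + (da + (2 * N + (db + m)))"
  have q_path: "positive_path p n q"
    unfolding q_def n_def using r1 z0 by (intro positive_path_join) auto
  have q1: "q (m + k) = r1 k" for k
    unfolding q_def using r1 by (simp add: path_join_right)
  have q2: "q (m + da + k) = r2 k" for k
    unfolding add.assoc q1 unfolding r1_def using r2 by (simp add: path_join_right)
  have q3: "q (m + da + 2 * N + k) = r3 k" for k
    unfolding add.assoc[of "m + da"] q2 unfolding r2_def using r3 by (simp add: path_join_right)
  have q_z: "q k = z0 k" if "k \<le> m" for k using that by (simp add: q_def path_join_left)
  have q_a: "q (m + k) = a k" if "k \<le> da" for k using that by (simp add: q1 r1_def path_join_left)
  have q_cyc: "q (m + da + k) = cyc k" if "k \<le> 2 * N" for k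
    using that by (simp add: q2 r2_def path_join_left)
  have q_b: "q (m + da + 2 * N + k) = b k" if "k \<le> db" for k
    using that by (simp add: q3 r3_def path_join_left)
  have q_z': "q (m + da + 2 * N + db + k) = z0 k" for k
    unfolding add.assoc[of "m + da + 2 * N"] q3 unfolding r3_def using b z0 by (simp add: path_join_right)
  define B where "B k = (if k \<le> m \<or> m + da + 2 * N + db \<le> k then cluster_set C n0
    else dominance_set n0 (q k))" for k
  define r where "r = N + db + m"
  have rn: "r \<le> n" "n - r = m + da + N" by (simp_all add: r_def n_def)
  have B_pos: "measure (P (q k)) (B k) > 0" if "k \<le> n" for k
  proof -
    consider "k \<le> m" | d where "k = m + da + 2 * N + db + d" "d \<le> m"
      | "\<not> (k \<le> m \<or> m + da + 2 * N + db \<le> k)"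
      using \<open>k \<le> n\<close> by (force simp: n_def le_iff_add)
    then show ?thesis
    proof cases
      case 1 then show ?thesis by (simp add: B_def q_z z0 Z_pos)
    next
      case 2 then show ?thesis unfolding 2(1) q_z' by (simp add: B_def z0 Z_pos)
    next
      case 3 then show ?thesis by (simp only: B_def if_False D_pos)
    qed
  qed
  have barrier: "is_barrier \<pi> p f r l y" if "y \<in> listset (map B [0..<Suc n])" for y
  proof -
    have len: "length y = Suc n" and y: "\<And>k. k \<le> n \<Longrightarrow> y ! k \<in> B k"
      using that unfolding in_listset_iff by (auto simp: less_Suc_eq_le simp del: upt_Suc)
    have B_D: "y ! k \<in> dominance_set n0 (q k)" if "m < k" "k < m + da + 2 * N + db" for k
      using y[of k] that by (simp add: B_def n_def)
    have "is_barrier \<pi> p f (N + db + m) (cyc N) y"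
    proof (rule barrier_block[of \<pi> p f \<eta> "1 - \<delta>" ?K "cluster_set C n0" C "dominance_set n0" m c0 da a cyc db b N y])
      show "\<pi> i \<ge> 0" for i using stationary_pos by (simp add: less_imp_le)
      show "\<eta> \<le> p i j" if "p i j > 0" for i j using \<epsilon>(2)[OF that] \<eta> by linarith
      show "f i x \<ge> \<eta>" if "x \<in> cluster_set C n0" "i \<in> C" for x i
        using that \<eta>(3) unfolding cluster_set_def \<delta>_def by fastforce
      show "f i x \<le> ?K" if "x \<in> cluster_set C n0" for x i
      proof -
        have "f i x \<le> real n0" using that unfolding cluster_set_def by blast
        then show ?thesis by simp
      qed
      show "f i x = 0" if "x \<in> cluster_set C n0" "i \<notin> C" for x i
        using that unfolding cluster_set_def by blast
      show "f s x \<ge> \<eta>" if "x \<in> dominance_set n0 s" for x s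
        using that \<eta>(3) unfolding dominance_set_def \<delta>_def by fastforce
      show "f i x \<le> ?K" if "x \<in> dominance_set n0 s" for x s i
      proof -
        have "f i x \<le> real n0" using that unfolding dominance_set_def by blast
        then show ?thesis by simp
      qed
      show "f i x * Max (range (\<lambda>j. p j i)) \<le> (1 - \<delta>) * (f s x * Max (range (\<lambda>j. p j s)))"
        if "x \<in> dominance_set n0 s" "i \<noteq> s" for x s i
        using that unfolding dominance_set_def column_max_def \<delta>_def by blast
      show "p (cyc t) (cyc (Suc t)) = Max (range (\<lambda>i. p i (cyc (Suc t))))" if "t < 2 * N" for t
        using cyc(1)[OF that] by (simp add: column_max_def)
      show "y ! k \<in> cluster_set C n0" if "k \<le> m" for k
        using y[of k] that by (simp add: B_def n_def)
      show "y ! (m + k) \<in> dominance_set n0 (a k)" if "0 < k" "k \<le> da" for k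
        using B_D[of "m + k"] q_a[of k] that b(1) by simp
      show "y ! (m + da + k) \<in> dominance_set n0 (cyc k)" if "0 < k" "k \<le> 2 * N" for k
        using B_D[of "m + da + k"] q_cyc[of k] that b(1) by simp
      show "y ! (m + da + 2 * N + k) \<in> dominance_set n0 (b k)" if "0 < k" "k < db" for k
        using B_D[of "m + da + 2 * N + k"] q_b[of k] that by simp
      show "y ! (m + da + 2 * N + db + k) \<in> cluster_set C n0" if "k \<le> m" for k
        using y[of "m + da + 2 * N + db + k"] that by (simp add: B_def n_def)
      show "length y = m + da + 2 * N + db + m + 1" using len by (simp add: n_def)
    qed (use p_nonneg f_nonneg transition_le_1 \<eta> \<delta> conn c0 a b cyc small in auto)
    then show ?thesis by (simp add: cyc r_def)
  qed
  have "q (n - r) = l" using q_cyc[of N] by (simp add: rn cyc)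
  moreover have "\<forall>k. B k \<in> sets borel"
    by (simp add: B_def cluster_set_borel dominance_set_borel)
  ultimately show ?thesis using rn(1) barrier q_path B_pos by blast
qed

end

theorem lemma3p1:
  fixes \<Omega> :: "'w measure"
    and Y :: "nat \<Rightarrow> 'w \<Rightarrow> 's::finite"
    and p :: "'s \<Rightarrow> 's \<Rightarrow> real"
    and \<pi> :: "'s \<Rightarrow> real"
    and X :: "nat \<Rightarrow> 'w \<Rightarrow> 'x::{metric_space, second_countable_topology}"
    and P :: "'s \<Rightarrow> 'x measure"
    and lam :: "'x measure"
    and f :: "'s \<Rightarrow> 'x \<Rightarrow> real"
  assumes "hidden_markov_model \<Omega> Y p \<pi> X P lam f"
    and "\<And>l. measure (P l) {x. \<forall>i. i \<noteq> l \<longrightarrow>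
           f l x * Max (range (\<lambda>j. p j l)) > f i x * Max (range (\<lambda>j. p j i))} > 0"
    and "\<exists>C m. cluster P f C \<and> (\<forall>i\<in>C. \<forall>j\<in>C. submatrix_power p C m i j \<noteq> 0)"
  shows "\<exists>(M::nat) (r::nat) (Bs :: 'x set list) (q :: 's list) l.
           M > r \<and> length Bs = M \<and> set Bs \<subseteq> sets borel \<and> length q = M \<and>
           (\<forall>y \<in> listset Bs. is_barrier \<pi> p f r l y) \<and>
           q ! (M - r - 1) = l \<and>
           \<P>(\<omega> in \<Omega>. map (\<lambda>i. X i \<omega>) [1..<Suc M] \<in> listset Bs
                     \<bar> map (\<lambda>i. Y i \<omega>) [1..<Suc M] = q) > 0 \<and>
           \<P>(\<omega> in \<Omega>. map (\<lambda>i. Y i \<omega>) [1..<Suc M] = q) > 0"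
proof -
  interpret hidden_markov_model \<Omega> Y p \<pi> X P lam f by (rule assms(1))
  obtain C m where C: "cluster P f C" "\<And>i j. i \<in> C \<Longrightarrow> j \<in> C \<Longrightarrow> submatrix_power p C m i j \<noteq> 0"
    using assms(3) by blast
  obtain n r B q l where *: "r \<le> n" "\<forall>k. B k \<in> sets borel"
    "\<forall>y \<in> listset (map B [0..<Suc n]). is_barrier \<pi> p f r l y" "q (n - r) = l"
    and path: "positive_path p n q" "\<And>k. k \<le> n \<Longrightarrow> measure (P (q k)) (B k) > 0"
    using barrier_exists[OF assms(2)[folded column_max_def] C] by blast
  have B: "B k \<in> sets borel" for k using *(2) by blast
  show ?thesis
  proof (rule exI[of _ "Suc n"], rule exI[of _ r], rule exI[of _ "map B [0..<Suc n]"],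
      rule exI[of _ "map q [0..<Suc n]"], rule exI[of _ l], intro conjI)
    show "\<P>(\<omega> in \<Omega>. map (\<lambda>i. Y i \<omega>) [1..<Suc (Suc n)] = map q [0..<Suc n]) > 0"
      "\<P>(\<omega> in \<Omega>. map (\<lambda>i. X i \<omega>) [1..<Suc (Suc n)] \<in> listset (map B [0..<Suc n])
        \<bar> map (\<lambda>i. Y i \<omega>) [1..<Suc (Suc n)] = map q [0..<Suc n]) > 0"
      by (rule block_prob_pos[OF path(1) B path(2)]; assumption)+
    have "Suc n - r - 1 < Suc n" by simp
    then show "map q [0..<Suc n] ! (Suc n - r - 1) = l"
      using *(4) by (simp del: upt_Suc)
  qed (use * in \<open>auto simp del: upt_Suc\<close>)
qed

end
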